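(* Let $d_{\max}\in[0,1)$. Assume that for every $k=0,\dots,N-1$: $h_k(u)>0$ for every $u\in\mathbb{R}^m\setminus\{\mathbf{0}\}$; and $X(k)$ is independent of $\mathcal{F}_k$ and has a (stage-dependent) distribution supported on $\mathcal{X}_k$. Then for every $k=0,\dots,N$ and every $(v,w)\in\mathcal{S}_{d_{\max}}$, $$\sup_{\pi\in\Pi_k^{\mathrm{safe}}}\mathbb{E}_k^{v,w}\bigl[V_\pi(N)\bigr]=w\,J_k\!\left(\frac{v}{w}\right).\qquad(\ast)$$ Moreover, for each $k=0,\dots,N-1$ there exists a Borel-measurable function $\gamma_k^\star:[1-d_{\max},1]\to\Gamma_k$ such that $\gamma=\gamma_k^\star(z)$ attains the maximum in the Bellman recursion defining $J_k(z)$, for every $z\in[1-d_{\max},1]$. The resulting feedback law $$u^{\pi^\star}(k)=V_{\max}(k)\bigl[z(k)-(1-d_{\max})\bigr]\gamma_k^\star\bigl(z(k)\bigr),\qquad z(k)=\frac{V(k)}{V_{\max}(k)},$$ defines a causal policy $\pi^\star$ that renders $\mathcal{S}_{d_{\max}}$ robustly invariant and attains the supremum in $(\ast)$. In particular, starting from $V(0)=V_{\max}(0)=V_0$ at stage $0$, $$\mathbb{E}[V_{\pi^\star}(N)]=V_0J_0(1),\qquad \mathbb{E}[R_{\pi^\star}]=J_0(1)-1.$$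
   Context: Fix $N\ge1$, $m\ge1$, $V_0>0$, a cost vector $\varepsilon\in\mathbb{R}_+^m$ (componentwise nonnegative), nonempty compact sets $\mathcal{X}_k\subset\mathbb{R}^m$, and random vectors $X(k)$ in $\mathbb{R}^m$ (asset returns) with $\mathbb{P}(X(k)\in\mathcal{X}_k)=1$, $k=0,\dots,N-1$. $\mathcal{F}_0$ is trivial and $\mathcal{F}_k:=\sigma(X(0),\dots,X(k-1))$. $|u|$ is the vector of componentwise absolute values; $\sigma_{\mathcal{X}}(z):=\sup_{x\in\mathcal{X}}z^\top x$; $\mathbb{R}_+=[0,\infty)$. Dynamics: from a state $(V(k),V_{\max}(k))$, under control $u(k)\in\mathbb{R}^m$ and return $X(k)$, $V(k+1)=V(k)+u(k)^\top X(k)-\varepsilon^\top|u(k)|$ and $V_{\max}(k+1)=\max\{V_{\max}(k),V(k+1)\}$. $V_\pi$ denotes the account value under policy $\pi$, and $R_\pi:=(V_\pi(N)-V_0)/V_0$. A causal policy is a sequence $\pi=\{\pi_k\}_{k=0}^{N-1}$ of measurable decision rules $\pi_k:\mathcal{X}_0\times\cdots\times\mathcal{X}_{k-1}\to\mathbb{R}^m$ ($\pi_0$ is a constant vector), generating the controls $u^\pi(0)=\pi_0$ and $u^\pi(k)=\pi_k(X(0),\dots,X(k-1))$; thus $u^\pi(k)$ is $\mathcal{F}_k$-measurable. Drawdown-safe set: $\mathcal{S}_{d_{\max}}:=\{(v,w)\in\mathbb{R}_+^2: w>0,\ (1-d_{\max})w\le v\le w\}$. A causal policy $\pi$ is robustly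 safe, equivalently $\mathcal{S}_{d_{\max}}$ is robustly invariant under $\pi$, if, for every stage $k=0,\dots,N-1$ and every current state $(V(k),V_{\max}(k))\in\mathcal{S}_{d_{\max}}$, the control prescribed by $\pi$ yields $(V(k+1),V_{\max}(k+1))\in\mathcal{S}_{d_{\max}}$ for every stage-$k$ return $x\in\mathcal{X}_k$. For $k=0,\dots,N$, $\Pi_k^{\mathrm{safe}}$ denotes the robustly safe causal policy sequences over stages $k,\dots,N-1$ (the same requirement imposed at the stages $k,\dots,N-1$). $\mathbb{E}_k^{v,w}$ denotes expectation for the process initialized at stage $k$ from $(V(k),V_{\max}(k))=(v,w)$. For $k=N$ no decisions remain and $V_\pi(N)=v$. $h_k(u):=\sigma_{\mathcal{X}_k}(-u)+\varepsilon^\top|u|$ and $\Gamma_k:=\{\gamma\in\mathbb{R}^m:h_k(\gamma)\le1\}$. Reduced Bellman recursion: for $z\in[1-d_{\max},1]$, $\gamma\in\Gamma_k$, $x\in\mathcal{X}_k$ let $\widehat v^+(z,\gamma,x):=z+[z-(1-d_{\max})](\gamma^\top x-\varepsilon^\top|\gamma|)$, $\widehat w^+(z,\gamma,x):=\max\{1,\widehat v^+(z,\gamma,x)\}$, $z^+(z,\gamma,x):=\widehat v^+(z,\gamma,x)/\widehat w^+(z,\gamma,x)$ (which lies in $[1-d_{\max},1]$). Set $J_N(z):=z$ and, for $k=N-1,\dots,0$, $$J_k(z):=\sup_{\gamma\in\Gamma_k}\mathbb{E}\Bigl[\widehat w^+\bigl(z,\gamma,X(k)\bigr)\,J_{k+1}\bigl(z^+(z,\gamma,X(k))\bigr)\Bigr],\qquad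 z\in[1-d_{\max},1].$$ *)

theory Defs
  imports "HOL-Probability.Probability"
begin

text \<open>
  Vectors are of type \<open>real^'m\<close>; on this type \<open>\<bar>u\<bar>\<close> is the vector of componentwise absolute values.
  Return paths are functions \<open>x :: nat \<Rightarrow> real^'m\<close>, of which only the components \<open>x 0, \<dots>, x (N - 1)\<close>
  matter. A state is a pair \<open>(V, V_max)\<close>.
\<close>

definition support_fun :: "(real^'m) set \<Rightarrow> real^'m \<Rightarrow> real" where
  "support_fun K z = (SUP x\<in>K. z \<bullet> x)"

definition worst_loss :: "real^'m \<Rightarrow> (real^'m) set \<Rightarrow> real^'m \<Rightarrow> real" where
  "worst_loss \<epsilon> K u = support_fun K (- u) + \<epsilon> \<bullet> \<bar>u\<bar>"

definition Gam :: "real^'m \<Rightarrow> (real^'m) set \<Rightarrow> (real^'m) set" where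
  "Gam \<epsilon> K = {\<gamma>. worst_loss \<epsilon> K \<gamma> \<le> 1}"

definition past_algebra :: "'a measure \<Rightarrow> (nat \<Rightarrow> 'a \<Rightarrow> real^'m) \<Rightarrow> nat \<Rightarrow> 'a measure" where
  "past_algebra M X k = sigma (space M) (\<Union>i<k. {X i -` A \<inter> space M | A. A \<in> sets borel})"

definition safe_set :: "real \<Rightarrow> (real \<times> real) set" where
  "safe_set d = {(v, w). 0 \<le> v \<and> 0 \<le> w \<and> 0 < w \<and> (1 - d) * w \<le> v \<and> v \<le> w}"

definition step :: "real^'m \<Rightarrow> real^'m \<Rightarrow> real^'m \<Rightarrow> real \<times> real \<Rightarrow> real \<times> real" where
  "step \<epsilon> u x = (\<lambda>(v, w). let v' = v + u \<bullet> x - \<epsilon> \<bullet> \<bar>u\<bar> in (v', max w v'))"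

text \<open>
  \<open>run \<epsilon> U k s x j\<close> is the state at stage \<open>j \<ge> k\<close> on the return path \<open>x\<close> when the process is initialized
  at stage \<open>k\<close> from \<open>s\<close> and the control at stage \<open>i\<close> in state \<open>t\<close> is \<open>U i t\<close>. For \<open>j < k\<close> the value
  is \<open>s\<close> by convention.
\<close>

primrec run :: "real^'m \<Rightarrow> (nat \<Rightarrow> real \<times> real \<Rightarrow> real^'m) \<Rightarrow> nat \<Rightarrow> real \<times> real \<Rightarrow>
    (nat \<Rightarrow> real^'m) \<Rightarrow> nat \<Rightarrow> real \<times> real" where
  "run \<epsilon> U k s x 0 = s"
| "run \<epsilon> U k s x (Suc j) =
     (if j < k then s else step \<epsilon> (U j (run \<epsilon> U k s x j)) (x j) (run \<epsilon> U k s x j))"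

type_synonym 'm policy = "nat \<Rightarrow> (nat \<Rightarrow> real^'m) \<Rightarrow> real^'m"

text \<open>
  The decision rule of stage \<open>j\<close> is a measurable function on \<open>\<X> 0 \<times> \<dots> \<times> \<X> (j - 1)\<close>, which is
  represented by the extensional product over \<open>{..<j}\<close>. For \<open>j = 0\<close> this is a one-point space.
\<close>

definition causal_policies :: "(nat \<Rightarrow> (real^'m) set) \<Rightarrow> nat \<Rightarrow> nat \<Rightarrow> 'm policy set" where
  "causal_policies \<X> N k =
     {\<pi>. \<forall>j\<in>{k..<N}. \<pi> j \<in> (\<Pi>\<^sub>M i\<in>{..<j}. restrict_space borel (\<X> i)) \<rightarrow>\<^sub>M borel}"

text \<open>
  The control \<open>\<pi>\<^sub>j(x 0, \<dots>, x (j - 1))\<close>. Random returns lie in the sets \<open>\<X> i\<close> only almost surely;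
  outside the domain of the decision rule the control is set to \<open>0\<close>, so that it is a random vector.
\<close>

definition control :: "(nat \<Rightarrow> (real^'m) set) \<Rightarrow> 'm policy \<Rightarrow> nat \<Rightarrow> (nat \<Rightarrow> real^'m) \<Rightarrow> real^'m" where
  "control \<X> \<pi> j x =
     (if restrict x {..<j} \<in> (\<Pi>\<^sub>E i\<in>{..<j}. \<X> i) then \<pi> j (restrict x {..<j}) else 0)"

definition policy_state :: "real^'m \<Rightarrow> (nat \<Rightarrow> (real^'m) set) \<Rightarrow> 'm policy \<Rightarrow> nat \<Rightarrow> real \<times> real \<Rightarrow>
    (nat \<Rightarrow> real^'m) \<Rightarrow> nat \<Rightarrow> real \<times> real" where
  "policy_state \<epsilon> \<X> \<pi> k s x = run \<epsilon> (\<lambda>j t. control \<X> \<pi> j x) k s x"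

text \<open>
  The robustly safe causal policies over the stages \<open>k, \<dots>, N - 1\<close> for the process initialized at
  stage \<open>k\<close> from \<open>s\<close>. Decision rules see only past returns, so the current state at stage \<open>j\<close> is the
  one that the policy has generated from \<open>s\<close> along the observed history, and the history ranges
  over all of \<open>\<X> 0 \<times> \<dots> \<times> \<X> (j - 1)\<close>. (Requiring one and the same control to be safe in all
  states of the safe set at once would leave only the zero control.)
\<close>

definition safe_policies :: "real^'m \<Rightarrow> real \<Rightarrow> (nat \<Rightarrow> (real^'m) set) \<Rightarrow> nat \<Rightarrow> nat \<Rightarrow> real \<times> real \<Rightarrow>
    'm policy set" where
  "safe_policies \<epsilon> d \<X> N k s = {\<pi> \<in> causal_policies \<X> N k.
     \<forall>j\<in>{k..<N}. \<forall>x. (\<forall>i<j. x i \<in> \<X> i) \<longrightarrow> policy_state \<epsilon> \<X> \<pi> k s x j \<in> safe_set d \<longrightarrow>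
       (\<forall>y\<in>\<X> j. step \<epsilon> (control \<X> \<pi> j x) y (policy_state \<epsilon> \<X> \<pi> k s x j) \<in> safe_set d)}"

definition terminal_value :: "(nat \<Rightarrow> 'a \<Rightarrow> real^'m) \<Rightarrow> real^'m \<Rightarrow> (nat \<Rightarrow> (real^'m) set) \<Rightarrow> nat \<Rightarrow>
    nat \<Rightarrow> real \<times> real \<Rightarrow> 'm policy \<Rightarrow> 'a \<Rightarrow> real" where
  "terminal_value X \<epsilon> \<X> N k s \<pi> \<omega> = fst (policy_state \<epsilon> \<X> \<pi> k s (\<lambda>i. X i \<omega>) N)"

definition v_plus :: "real^'m \<Rightarrow> real \<Rightarrow> real \<Rightarrow> real^'m \<Rightarrow> real^'m \<Rightarrow> real" where
  "v_plus \<epsilon> d z \<gamma> x = z + (z - (1 - d)) * (\<gamma> \<bullet> x - \<epsilon> \<bullet> \<bar>\<gamma>\<bar>)"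

definition w_plus :: "real^'m \<Rightarrow> real \<Rightarrow> real \<Rightarrow> real^'m \<Rightarrow> real^'m \<Rightarrow> real" where
  "w_plus \<epsilon> d z \<gamma> x = max 1 (v_plus \<epsilon> d z \<gamma> x)"

definition z_plus :: "real^'m \<Rightarrow> real \<Rightarrow> real \<Rightarrow> real^'m \<Rightarrow> real^'m \<Rightarrow> real" where
  "z_plus \<epsilon> d z \<gamma> x = v_plus \<epsilon> d z \<gamma> x / w_plus \<epsilon> d z \<gamma> x"

definition bellman_objective :: "'a measure \<Rightarrow> ('a \<Rightarrow> real^'m) \<Rightarrow> real^'m \<Rightarrow> real \<Rightarrow> (real \<Rightarrow> real) \<Rightarrow>
    real \<Rightarrow> real^'m \<Rightarrow> real" where
  "bellman_objective M Y \<epsilon> d F z \<gamma> =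
     (\<integral>\<omega>. w_plus \<epsilon> d z \<gamma> (Y \<omega>) * F (z_plus \<epsilon> d z \<gamma> (Y \<omega>)) \<partial>M)"

text \<open>
  The functions \<open>J\<^sub>k\<close> live on \<open>[1 - d, 1]\<close>. For \<open>k < N\<close> they are extended by \<open>0\<close>; the extension enters the
  expectation only on the null event that a return falls outside its set \<open>\<X> k\<close>.
\<close>

function J :: "'a measure \<Rightarrow> (nat \<Rightarrow> 'a \<Rightarrow> real^'m) \<Rightarrow> real^'m \<Rightarrow> real \<Rightarrow> (nat \<Rightarrow> (real^'m) set) \<Rightarrow>
    nat \<Rightarrow> nat \<Rightarrow> real \<Rightarrow> real" where
  "J M X \<epsilon> d \<X> N k =
     (if k < N
      then (\<lambda>z. if z \<in> {1 - d..1}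
                then SUP \<gamma>\<in>Gam \<epsilon> (\<X> k). bellman_objective M (X k) \<epsilon> d (J M X \<epsilon> d \<X> N (Suc k)) z \<gamma>
                else 0)
      else (\<lambda>z. z))"
  by pat_completeness auto
termination
  by (relation "Wellfounded.measure (\<lambda>(M, X, \<epsilon>, d, \<X>, N, k). N - k)") auto

declare J.simps [simp del]

definition bellman_selector :: "'a measure \<Rightarrow> (nat \<Rightarrow> 'a \<Rightarrow> real^'m) \<Rightarrow> real^'m \<Rightarrow> real \<Rightarrow>
    (nat \<Rightarrow> (real^'m) set) \<Rightarrow> nat \<Rightarrow> nat \<Rightarrow> (real \<Rightarrow> real^'m) \<Rightarrow> bool" where
  "bellman_selector M X \<epsilon> d \<X> N k \<gamma> \<longleftrightarrow>
     \<gamma> \<in> restrict_space borel {1 - d..1} \<rightarrow>\<^sub>M restrict_space borel (Gam \<epsilon> (\<X> k)) \<and>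
     (\<forall>z\<in>{1 - d..1}.
        bellman_objective M (X k) \<epsilon> d (J M X \<epsilon> d \<X> N (Suc k)) z (\<gamma> z) = J M X \<epsilon> d \<X> N k z \<and>
        (\<forall>\<gamma>'\<in>Gam \<epsilon> (\<X> k). bellman_objective M (X k) \<epsilon> d (J M X \<epsilon> d \<X> N (Suc k)) z \<gamma>'
                            \<le> bellman_objective M (X k) \<epsilon> d (J M X \<epsilon> d \<X> N (Suc k)) z (\<gamma> z)))"

definition feedback :: "real \<Rightarrow> (nat \<Rightarrow> real \<Rightarrow> real^'m) \<Rightarrow> nat \<Rightarrow> real \<times> real \<Rightarrow> real^'m" where
  "feedback d \<gamma> j = (\<lambda>(v, w). (w * (v / w - (1 - d))) *\<^sub>R \<gamma> j (v / w))"

text \<open>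
  The causal policy generated by the feedback law: the decision rule of stage \<open>j\<close> reconstructs the
  current closed-loop state from the initial state \<open>s\<close> at stage \<open>k\<close> and the observed returns.
\<close>

definition feedback_policy :: "real^'m \<Rightarrow> real \<Rightarrow> (nat \<Rightarrow> real \<Rightarrow> real^'m) \<Rightarrow> nat \<Rightarrow> real \<times> real \<Rightarrow>
    'm policy" where
  "feedback_policy \<epsilon> d \<gamma> k s j x = feedback d \<gamma> j (run \<epsilon> (feedback d \<gamma>) k s x j)"

end

theory Submission
  imports Defs
begin

text \<open>
  A control is robustly safe in the state \<open>(v, w)\<close> exactly when it is \<open>(v - (1 - d) w) \<gamma>\<close> with
  \<open>\<gamma> \<in> \<Gamma>\<^sub>k\<close>; in these coordinates the dynamics are homogeneous in \<open>w\<close> and reduce to the ratio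
  \<open>z = v / w\<close>. Positivity of \<open>h\<^sub>k\<close> makes \<open>\<Gamma>\<^sub>k\<close> compact, so every \<open>J\<^sub>k\<close> is continuous and its
  recursion has a Borel maximiser. By independence of \<open>X(k)\<close> from the past and Fubini's theorem,
  \<open>E[V_max(k) J\<^sub>k(z(k))]\<close> is nonincreasing in \<open>k\<close> along every safe policy and constant along the
  feedback law.
\<close>

section \<open>Maximisation and integration with parameters\<close>

text \<open>Two obstacles shape the argument. Returns lie in \<open>\<X> k\<close> only almost
  surely, so controls, and \<open>J\<close> at stages before \<open>N\<close>, carry zero defaults,
  and pathwise identities are used almost everywhere. And the upper bound must cover arbitrary safe
  policies, whose normalised control \<gamma> is chosen path by path with no measurability. Hence
  the value process is integrated in \<open>ennreal\<close>: comparison and almost-everywhere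
  equality of nonnegative integrals ask nothing of \<gamma>, and no integrability of the wealth has
  to be known in advance. Only the actual control, which is measurable with respect to the past,
  enters the Fubini step. Positivity of h_k acts twice: it bounds \<Gamma>_k, and on the floor v =
  (1 - d) w, where the coordinate \<gamma> degenerates, it leaves the zero control as the only safe
  one.\<close>

lemma continuous_on_slice:
  assumes "continuous_on (A \<times> B) (\<lambda>(a, b). g a b)"
  shows "b \<in> B \<Longrightarrow> continuous_on A (\<lambda>a. g a b)"
    and "a \<in> A \<Longrightarrow> continuous_on B (\<lambda>b. g a b)"
proof -
  show "continuous_on A (\<lambda>a. g a b)" if "b \<in> B"
  proof -
    have "continuous_on A (\<lambda>a. case (a, b) of (a, b) \<Rightarrow> g a b)"
      by (rule continuous_on_compose2[OF assms]) (use that in \<open>auto intro!: continuous_intros\<close>)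
    then show ?thesis by simp
  qed
  show "continuous_on B (\<lambda>b. g a b)" if "a \<in> A"
  proof -
    have "continuous_on B (\<lambda>b. case (a, b) of (a, b) \<Rightarrow> g a b)"
      by (rule continuous_on_compose2[OF assms]) (use that in \<open>auto intro!: continuous_intros\<close>)
    then show ?thesis by simp
  qed
qed

text \<open>By compactness the minimisers meet \<open>C\<close> iff \<open>A z\<close> meets
  \<open>C\<close> and the minimum of \<open>\<phi>\<close> over \<open>A z \<inter> C\<close> is no
  larger than the one over \<open>A z\<close>. Rational levels reduce this comparison to countably
  many hitting events of closed sets.\<close>

lemma argmin_weakly_measurable:
  fixes A :: "'a \<Rightarrow> 'b::metric_space set" and \<phi> :: "'b \<Rightarrow> real"
  defines "B \<equiv> \<lambda>z. {y \<in> A z. \<forall>y'\<in>A z. \<phi> y \<le> \<phi> y'}"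
  assumes cpt: "\<And>z. z \<in> space S \<Longrightarrow> compact (A z)"
    and ne: "\<And>z. z \<in> space S \<Longrightarrow> A z \<noteq> {}"
    and meas: "\<And>C. closed C \<Longrightarrow> {z \<in> space S. A z \<inter> C \<noteq> {}} \<in> sets S"
    and cont: "continuous_on UNIV \<phi>"
  shows "\<And>z. z \<in> space S \<Longrightarrow> compact (B z)"
    and "\<And>z. z \<in> space S \<Longrightarrow> B z \<noteq> {}"
    and "\<And>C. closed C \<Longrightarrow> {z \<in> space S. B z \<inter> C \<noteq> {}} \<in> sets S"
proof -
  have cont': "continuous_on T \<phi>" for T
    using cont continuous_on_subset by blast
  have sub: "closed {y. \<phi> y \<le> c}" for c
    by (intro closed_Collect_le cont continuous_on_const)
  show "compact (B z)" if "z \<in> space S" for z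
  proof -
    have "B z = A z \<inter> (\<Inter>y'\<in>A z. {y. \<phi> y \<le> \<phi> y'})"
      by (auto simp: B_def)
    then show ?thesis
      using cpt[OF that] sub by (auto intro!: compact_Int_closed closed_INT)
  qed
  show "B z \<noteq> {}" if "z \<in> space S" for z
    using continuous_attains_inf[OF cpt[OF that] ne[OF that] cont'] by (auto simp: B_def)
  fix C :: "'b set" assume C: "closed C"
  \<comment> \<open>At every rational level \<open>c\<close>: if \<open>A z\<close> reaches down to
    \<open>c\<close>, so does \<open>A z \<inter> C\<close>. A gap between the two minima would
    contain a level violating this.\<close>
  have "{z \<in> space S. B z \<inter> C \<noteq> {}} = {z \<in> space S. A z \<inter> C \<noteq> {}} \<inter>
      (\<Inter>c\<in>\<rat>. (space S - {z \<in> space S. A z \<inter> {y. \<phi> y \<le> c} \<noteq> {}}) \<union>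
             {z \<in> space S. A z \<inter> (C \<inter> {y. \<phi> y \<le> c}) \<noteq> {}})" (is "?L = ?R")
  proof
    show "?L \<subseteq> ?R"
      unfolding B_def by (auto simp: set_eq_iff) (metis order_trans)+
    show "?R \<subseteq> ?L"
    proof
      fix z assume z: "z \<in> ?R"
      then have zS: "z \<in> space S" by auto
      obtain y0 where y0: "y0 \<in> A z \<inter> C" "\<And>y. y \<in> A z \<inter> C \<Longrightarrow> \<phi> y0 \<le> \<phi> y"
        using continuous_attains_inf[OF compact_Int_closed[OF cpt[OF zS] C] _ cont'] z by auto
      obtain y1 where y1: "y1 \<in> A z" "\<And>y. y \<in> A z \<Longrightarrow> \<phi> y1 \<le> \<phi> y"
        using continuous_attains_inf[OF cpt[OF zS] ne[OF zS] cont'] by auto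
      have "\<phi> y0 \<le> \<phi> y1"
      proof (rule ccontr)
        assume "\<not> \<phi> y0 \<le> \<phi> y1"
        then obtain c where c: "c \<in> \<rat>" "\<phi> y1 < c" "c < \<phi> y0"
          using Rats_dense_in_real[of "\<phi> y1" "\<phi> y0"] by auto
        from z c(1) have "A z \<inter> {y. \<phi> y \<le> c} = {} \<or> A z \<inter> (C \<inter> {y. \<phi> y \<le> c}) \<noteq> {}"
          by blast
        then show False
        proof
          assume "A z \<inter> {y. \<phi> y \<le> c} = {}"
          then show False using y1(1) c(2) by (auto simp: disjoint_iff)
        next
          assume "A z \<inter> (C \<inter> {y. \<phi> y \<le> c}) \<noteq> {}"
          then obtain y where "y \<in> A z \<inter> C" "\<phi> y \<le> c" by auto
          then show False using y0(2)[of y] c(3) by linarith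
        qed
      qed
      then have "y0 \<in> B z \<inter> C"
        using y0(1) y1(2) unfolding B_def by (auto intro: order_trans)
      then show "z \<in> ?L" using zS by auto
    qed
  qed
  also have "\<dots> \<in> sets S"
  proof (intro sets.Int meas C sets.countable_INT')
    show "\<rat> \<noteq> ({} :: real set)" using Rats_0 by blast
  qed (auto simp: countable_rat intro!: sets.Un sets.Diff meas sub closed_Int C)
  finally show "{z \<in> space S. B z \<inter> C \<noteq> {}} \<in> sets S" .
qed

text \<open>
  Minimising one coordinate after the other shrinks the sets to singletons, while hitting
  events of closed sets remain measurable.
\<close>

lemma measurable_selection_compact:
  fixes A :: "'a \<Rightarrow> 'b::euclidean_space set"
  assumes cpt: "\<And>z. z \<in> space S \<Longrightarrow> compact (A z)"
    and ne: "\<And>z. z \<in> space S \<Longrightarrow> A z \<noteq> {}"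
    and meas: "\<And>C. closed C \<Longrightarrow> {z \<in> space S. A z \<inter> C \<noteq> {}} \<in> sets S"
  obtains g where "g \<in> borel_measurable S" "\<And>z. z \<in> space S \<Longrightarrow> g z \<in> A z"
proof -
  \<comment> \<open>\<open>I\<close> collects the coordinates already minimised. The other clauses
    are what the next minimisation requires of its input.\<close>
  have "\<exists>B. (\<forall>z\<in>space S. compact (B z) \<and> B z \<noteq> {} \<and> B z \<subseteq> A z \<and>
              (\<forall>i\<in>I. \<forall>y\<in>B z. \<forall>y'\<in>B z. y \<bullet> i = y' \<bullet> i)) \<and>
            (\<forall>C. closed C \<longrightarrow> {z \<in> space S. B z \<inter> C \<noteq> {}} \<in> sets S)"
    if "finite I" for I :: "'b set"
    using that
  proof induction
    case empty
    show ?case using cpt ne meas by (intro exI[of _ A]) auto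
  next
    case (insert i I)
    from insert.IH obtain B where
      B0: "\<forall>z\<in>space S. compact (B z) \<and> B z \<noteq> {} \<and> B z \<subseteq> A z \<and>
              (\<forall>i\<in>I. \<forall>y\<in>B z. \<forall>y'\<in>B z. y \<bullet> i = y' \<bullet> i)"
      and B1: "\<forall>C. closed C \<longrightarrow> {z \<in> space S. B z \<inter> C \<noteq> {}} \<in> sets S"
      by (elim exE conjE)
    define B' where "B' z = {y \<in> B z. \<forall>y'\<in>B z. y \<bullet> i \<le> y' \<bullet> i}" for z
    have cont: "continuous_on UNIV (\<lambda>y. y \<bullet> i)"
      by (intro continuous_intros)
    have pre: "compact (B z)" "B z \<noteq> {}" if "z \<in> space S" for z
      using B0 that by auto
    have meas': "{z \<in> space S. B z \<inter> C \<noteq> {}} \<in> sets S" if "closed C" for C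
      using B1 that by simp
    note argmin = argmin_weakly_measurable[where S = S and A = B, OF pre meas' cont, folded B'_def]
    have *: "compact (B' z)" "B' z \<noteq> {}" if "z \<in> space S" for z
      by (rule argmin(1)[OF _ _ _ that], assumption+) (rule argmin(2)[OF _ _ _ that], assumption+)
    have **: "{z \<in> space S. B' z \<inter> C \<noteq> {}} \<in> sets S" if "closed C" for C
      by (rule argmin(3)[OF _ _ _ that])
    have ***: "y \<bullet> j = y' \<bullet> j"
      if "z \<in> space S" "j \<in> insert i I" "y \<in> B' z" "y' \<in> B' z" for z j y y'
      using that B0 unfolding B'_def by (cases "j = i") (auto intro: order_antisym)
    have "B' z \<subseteq> A z" if "z \<in> space S" for z
      using B0 that unfolding B'_def by blast
    then have "\<forall>z\<in>space S. compact (B' z) \<and> B' z \<noteq> {} \<and> B' z \<subseteq> A z \<and>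
              (\<forall>i\<in>insert i I. \<forall>y\<in>B' z. \<forall>y'\<in>B' z. y \<bullet> i = y' \<bullet> i)"
      using * by (intro ballI conjI) (assumption | rule ***)+
    with ** show ?case by blast
  qed
  from this[OF finite_Basis] obtain B where
    B0: "\<forall>z\<in>space S. compact (B z) \<and> B z \<noteq> {} \<and> B z \<subseteq> A z \<and>
            (\<forall>i\<in>Basis. \<forall>y\<in>B z. \<forall>y'\<in>B z. y \<bullet> i = y' \<bullet> i)"
    and B1: "\<forall>C. closed C \<longrightarrow> {z \<in> space S. B z \<inter> C \<noteq> {}} \<in> sets S"
    by (elim exE conjE)
  have B2: "\<forall>i\<in>Basis. \<forall>y\<in>B z. \<forall>y'\<in>B z. y \<bullet> i = y' \<bullet> i" if "z \<in> space S" for z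
    by (rule conjunct2[OF conjunct2[OF conjunct2[OF bspec[OF B0 that]]]])
  have B3: "B z \<noteq> {}" "B z \<subseteq> A z" if "z \<in> space S" for z
    by (rule conjunct1[OF conjunct2[OF bspec[OF B0 that]]],
        rule conjunct1[OF conjunct2[OF conjunct2[OF bspec[OF B0 that]]]])
  have uniq: "y = y'" if "z \<in> space S" "y \<in> B z" "y' \<in> B z" for z y y'
  proof (rule euclidean_eqI)
    fix i :: 'b assume "i \<in> Basis"
    from bspec[OF bspec[OF bspec[OF B2[OF that(1)] this] that(2)] that(3)]
    show "y \<bullet> i = y' \<bullet> i" .
  qed
  \<comment> \<open>As \<open>B z\<close> is a singleton, the preimage of a closed set under
    \<open>g\<close> is a hitting event of \<open>B\<close>.\<close>
  define g where "g z = (SOME y. y \<in> B z)" for z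
  have g: "g z \<in> B z" if "z \<in> space S" for z
    unfolding g_def some_in_eq using that by (rule B3)
  have "g -` C \<inter> space S \<in> sets S" if "closed C" for C
  proof -
    have "g -` C \<inter> space S = {z \<in> space S. B z \<inter> C \<noteq> {}}"
    proof (intro set_eqI iffI)
      fix z assume "z \<in> {z \<in> space S. B z \<inter> C \<noteq> {}}"
      then obtain y where "z \<in> space S" "y \<in> B z" "y \<in> C" by blast
      moreover from this have "g z = y" by (intro uniq[OF _ g])
      ultimately show "z \<in> g -` C \<inter> space S" by simp
    next
      fix z assume "z \<in> g -` C \<inter> space S"
      then have "z \<in> space S" "g z \<in> B z \<inter> C" using g by simp_all
      then show "z \<in> {z \<in> space S. B z \<inter> C \<noteq> {}}" by blast
    qed
    then show ?thesis using B1 that by simp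
  qed
  then have "g \<in> borel_measurable S"
    unfolding borel_eq_closed by (intro measurable_measure_of) auto
  moreover have "g z \<in> A z" if "z \<in> space S" for z
    using g[OF that] B3(2)[OF that] by blast
  ultimately show thesis
    by (rule that)
qed

text \<open>Uniform continuity on the compact product moves all \<open>f z y\<close> by less than
  \<open>e\<close> at once; attainment of both suprema keeps the inequality strict. Serves the value
  functions and the worst loss on the unit sphere.\<close>

lemma continuous_on_SUP_compact:
  fixes f :: "'a::metric_space \<Rightarrow> 'b::metric_space \<Rightarrow> real"
  assumes Z: "compact Z" and K: "compact K" "K \<noteq> {}"
    and f: "continuous_on (Z \<times> K) (\<lambda>(z, y). f z y)"
  shows "continuous_on Z (\<lambda>z. SUP y\<in>K. f z y)"
proof -
  have att: "\<exists>y\<in>K. (SUP y\<in>K. f z y) = f z y \<and> (\<forall>y'\<in>K. f z y' \<le> f z y)" if "z \<in> Z" for z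
  proof -
    have "continuous_on K (f z)"
      using continuous_on_slice(2)[OF f that] .
    then obtain y where y: "y \<in> K" "\<And>y'. y' \<in> K \<Longrightarrow> f z y' \<le> f z y"
      using continuous_attains_sup[OF K] by blast
    then have "(SUP y\<in>K. f z y) = f z y"
      by (intro cSup_eq_maximum) auto
    with y show ?thesis by blast
  qed
  have "uniformly_continuous_on (Z \<times> K) (\<lambda>(z, y). f z y)"
    using f Z K by (intro compact_uniformly_continuous compact_Times)
  show ?thesis
    unfolding continuous_on_iff
  proof (intro ballI allI impI)
    fix z and e :: real assume z: "z \<in> Z" and e: "0 < e"
    obtain \<delta> where \<delta>: "\<delta> > 0"
      "\<And>p q. \<lbrakk>p \<in> Z \<times> K; q \<in> Z \<times> K; dist q p < \<delta>\<rbrakk>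
        \<Longrightarrow> dist (case q of (z, y) \<Rightarrow> f z y) (case p of (z, y) \<Rightarrow> f z y) < e"
      using \<open>uniformly_continuous_on _ _\<close> e unfolding uniformly_continuous_on_def by blast
    have near: "\<bar>f z' y - f z y\<bar> < e" if "z' \<in> Z" "y \<in> K" "dist z' z < \<delta>" for z' y
      using \<delta>(2)[of "(z, y)" "(z', y)"] z that by (auto simp: dist_Pair_Pair dist_real_def)
    have "dist (SUP y\<in>K. f z' y) (SUP y\<in>K. f z y) < e" if z': "z' \<in> Z" "dist z' z < \<delta>" for z'
    proof -
      obtain y where y: "y \<in> K" "(SUP y\<in>K. f z y) = f z y" "\<forall>y'\<in>K. f z y' \<le> f z y"
        using att[OF z] by blast
      obtain y' where y': "y' \<in> K" "(SUP y\<in>K. f z' y) = f z' y'" "\<forall>y\<in>K. f z' y \<le> f z' y'"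
        using att[OF z'(1)] by blast
      show ?thesis
        using near[OF z'(1) y(1) z'(2)] near[OF z'(1) y'(1) z'(2)] y y'
        unfolding dist_real_def by (smt (verit) y(1) y'(1))
    qed
    then show "\<exists>d>0. \<forall>x'\<in>Z. dist x' z < d \<longrightarrow> dist (SUP y\<in>K. f x' y) (SUP y\<in>K. f z y) < e"
      using \<delta>(1) by blast
  qed
qed

text \<open>The maximisers form compact sets, and for closed \<open>C\<close> the event that they
  meet \<open>C\<close> is the projection of a compact set, hence closed.\<close>

lemma measurable_argmax:
  fixes f :: "'a::metric_space \<Rightarrow> 'b::euclidean_space \<Rightarrow> real"
  assumes Z: "compact Z" and K: "compact K" "K \<noteq> {}"
    and f: "continuous_on (Z \<times> K) (\<lambda>(z, y). f z y)"
  obtains g where "g \<in> restrict_space borel Z \<rightarrow>\<^sub>M restrict_space borel K"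
    "\<And>z y. \<lbrakk>z \<in> Z; y \<in> K\<rbrakk> \<Longrightarrow> f z y \<le> f z (g z)"
proof -
  define S where "S = (restrict_space borel Z :: 'a measure)"
  define A where "A z = {y \<in> K. \<forall>y'\<in>K. f z y' \<le> f z y}" for z
  have space: "space S = Z" by (simp add: S_def space_restrict_space)
  have fz: "continuous_on K (f z)" if "z \<in> Z" for z
    using continuous_on_slice(2)[OF f that] .
  have fy: "continuous_on Z (\<lambda>z. f z y)" if "y \<in> K" for y
    using continuous_on_slice(1)[OF f that] .
  have 1: "compact (A z)" if "z \<in> space S" for z
  proof -
    have "A z = K \<inter> (\<Inter>y'\<in>K. {y \<in> K. f z y' \<le> f z y})"
      by (auto simp: A_def)
    moreover have "closed {y \<in> K. f z y' \<le> f z y}" for y'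
      using fz[of z] that K space
      by (intro continuous_on_closed_Collect_le continuous_on_const compact_imp_closed) auto
    ultimately show ?thesis using K by (auto intro!: compact_Int_closed closed_INT)
  qed
  have 2: "A z \<noteq> {}" if "z \<in> space S" for z
    using continuous_attains_sup[OF K fz[of z]] that space by (auto simp: A_def)
  have 3: "{z \<in> space S. A z \<inter> C \<noteq> {}} \<in> sets S" if C: "closed C" for C
  proof -
    \<comment> \<open>The graph of the maximiser correspondence, cut down to \<open>C\<close>. Each
      conjunct compares with one fixed \<open>y'\<close>, so it is a closed condition on the
      pair.\<close>
    define P where "P = (Z \<times> (K \<inter> C)) \<inter> (\<Inter>y'\<in>K. {p \<in> Z \<times> (K \<inter> C). f (fst p) y' \<le> f (fst p) (snd p)})"
    have ZK: "compact (Z \<times> (K \<inter> C))"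
      using Z K C by (intro compact_Times compact_Int_closed)
    have "closed {p \<in> Z \<times> (K \<inter> C). f (fst p) y' \<le> f (fst p) (snd p)}" if "y' \<in> K" for y'
    proof (intro continuous_on_closed_Collect_le compact_imp_closed[OF ZK])
      show "continuous_on (Z \<times> (K \<inter> C)) (\<lambda>p. f (fst p) y')"
        by (rule continuous_on_compose2[OF fy[OF that]]) (auto intro!: continuous_intros)
      show "continuous_on (Z \<times> (K \<inter> C)) (\<lambda>p. f (fst p) (snd p))"
        by (rule continuous_on_subset[OF f[unfolded case_prod_beta]]) auto
    qed
    then have "compact P"
      unfolding P_def using K by (intro compact_Int_closed ZK closed_INT) auto
    then have "closed (fst ` P)"
      by (intro compact_imp_closed compact_continuous_image continuous_intros)
    moreover have "{z \<in> space S. A z \<inter> C \<noteq> {}} = fst ` P"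
    proof (intro set_eqI iffI)
      fix z assume "z \<in> {z \<in> space S. A z \<inter> C \<noteq> {}}"
      then obtain y where "z \<in> Z" "y \<in> A z" "y \<in> C"
        using space by blast
      then have "(z, y) \<in> P"
        by (auto simp: P_def A_def)
      then show "z \<in> fst ` P"
        by force
    next
      fix z assume "z \<in> fst ` P"
      then obtain y where "(z, y) \<in> P" by auto
      then have "z \<in> Z" "y \<in> A z \<inter> C"
        by (auto simp: P_def A_def)
      then show "z \<in> {z \<in> space S. A z \<inter> C \<noteq> {}}"
        using space by blast
    qed
    moreover have "fst ` P \<subseteq> Z" by (auto simp: P_def)
    ultimately show ?thesis
      by (simp add: S_def sets_restrict_space_iff Z compact_imp_closed borel_closed)
  qed
  obtain g where g: "g \<in> borel_measurable S" "\<And>z. z \<in> space S \<Longrightarrow> g z \<in> A z"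
    using measurable_selection_compact[of S A, OF 1 2 3] by blast
  show thesis
  proof (rule that[of g])
    show "g \<in> restrict_space borel Z \<rightarrow>\<^sub>M restrict_space borel K"
      using g by (intro measurable_restrict_space2) (auto simp: S_def space_restrict_space A_def)
    show "f z y \<le> f z (g z)" if "z \<in> Z" "y \<in> K" for z y
      using g(2)[of z] that space by (auto simp: A_def)
  qed
qed

text \<open>Dominated convergence with a constant bound, which exists by compactness.
  \<open>Y\<close> is in \<open>B\<close> only almost surely, so measurability of the composites
  does not come from continuity and is assumed separately.\<close>

lemma (in finite_measure) continuous_on_integral_compact:
  fixes g :: "'b::metric_space \<Rightarrow> 'c::metric_space \<Rightarrow> real"
  assumes A: "compact A" and B: "compact B"
    and g: "continuous_on (A \<times> B) (\<lambda>(a, b). g a b)"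
    and Y: "AE \<omega> in M. Y \<omega> \<in> B"
    and meas: "\<And>a. a \<in> A \<Longrightarrow> (\<lambda>\<omega>. g a (Y \<omega>)) \<in> borel_measurable M"
  shows "continuous_on A (\<lambda>a. \<integral>\<omega>. g a (Y \<omega>) \<partial>M)"
proof -
  have "bounded ((\<lambda>(a, b). g a b) ` (A \<times> B))"
    by (intro compact_imp_bounded compact_continuous_image g compact_Times A B)
  then obtain C where C: "\<And>a b. \<lbrakk>a \<in> A; b \<in> B\<rbrakk> \<Longrightarrow> \<bar>g a b\<bar> \<le> C"
    unfolding bounded_iff by force
  have gb: "continuous_on A (\<lambda>a. g a b)" if "b \<in> B" for b
    using continuous_on_slice(1)[OF g that] .
  show ?thesis
    unfolding continuous_on_sequentially o_def
  proof (intro allI ballI impI, elim conjE)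
    fix x a assume a: "a \<in> A" "\<forall>n. x n \<in> A" "x \<longlonglongrightarrow> a"
    show "(\<lambda>n. \<integral>\<omega>. g (x n) (Y \<omega>) \<partial>M) \<longlonglongrightarrow> (\<integral>\<omega>. g a (Y \<omega>) \<partial>M)"
    proof (rule integral_dominated_convergence[where w = "\<lambda>_. C"])
      show "AE \<omega> in M. (\<lambda>n. g (x n) (Y \<omega>)) \<longlonglongrightarrow> g a (Y \<omega>)"
        using Y
      proof eventually_elim
        case (elim \<omega>)
        show ?case
          using gb[OF elim] a unfolding continuous_on_sequentially o_def by blast
      qed
      show "AE \<omega> in M. norm (g (x n) (Y \<omega>)) \<le> C" for n
        using Y by eventually_elim (use C a in auto)
    qed (use a meas in auto)
  qed
qed

text \<open>The joint law of \<open>H\<close> and \<open>X\<close> is a product, so Tonelli lets a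
  fresh outcome \<open>\<omega>'\<close> drive \<open>X\<close> while the past stays at
  \<open>\<omega>\<close>. \<open>H\<close> will be the pair of current state and control.\<close>

lemma (in prob_space) nn_integral_indep:
  assumes ind: "indep_set {X -` A \<inter> space M | A. A \<in> sets S} (sets F)"
    and F: "subalgebra M F"
    and X: "X \<in> M \<rightarrow>\<^sub>M S" and H: "H \<in> F \<rightarrow>\<^sub>M T"
    and \<Phi>: "\<Phi> \<in> borel_measurable (T \<Otimes>\<^sub>M S)"
  shows "(\<integral>\<^sup>+\<omega>. \<Phi> (H \<omega>, X \<omega>) \<partial>M) = (\<integral>\<^sup>+\<omega>. \<integral>\<^sup>+\<omega>'. \<Phi> (H \<omega>, X \<omega>') \<partial>M \<partial>M)"
proof -
  have HM: "H \<in> M \<rightarrow>\<^sub>M T"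
    by (rule measurable_from_subalg[OF F H])
  interpret PX: prob_space "distr M S X" by (rule prob_space_distr[OF X])
  interpret PH: prob_space "distr M T H" by (rule prob_space_distr[OF HM])
  have eq: "distr M T H \<Otimes>\<^sub>M distr M S X = distr M (T \<Otimes>\<^sub>M S) (\<lambda>\<omega>. (H \<omega>, X \<omega>))"
  proof (rule pair_measure_eqI)
    fix A B assume A: "A \<in> sets (distr M T H)" and B: "B \<in> sets (distr M S X)"
    have "prob ((X -` B \<inter> space M) \<inter> (H -` A \<inter> space M)) =
        prob (X -` B \<inter> space M) * prob (H -` A \<inter> space M)"
      using measurable_sets[OF H, of A] A B F
      by (intro indep_setD[OF ind]) (auto simp: subalgebra_def)
    moreover have "(\<lambda>\<omega>. (H \<omega>, X \<omega>)) -` (A \<times> B) \<inter> space M =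
        (X -` B \<inter> space M) \<inter> (H -` A \<inter> space M)"
      by auto
    ultimately show "emeasure (distr M T H) A * emeasure (distr M S X) B =
        emeasure (distr M (T \<Otimes>\<^sub>M S) (\<lambda>\<omega>. (H \<omega>, X \<omega>))) (A \<times> B)"
      using A B HM X
      by (simp add: emeasure_distr emeasure_eq_measure ennreal_mult[symmetric] mult.commute)
  qed (auto intro: PX.sigma_finite_measure_axioms PH.sigma_finite_measure_axioms)
  have "(\<integral>\<^sup>+\<omega>. \<Phi> (H \<omega>, X \<omega>) \<partial>M) = (\<integral>\<^sup>+p. \<Phi> p \<partial>distr M (T \<Otimes>\<^sub>M S) (\<lambda>\<omega>. (H \<omega>, X \<omega>)))"
    using HM X \<Phi> by (subst nn_integral_distr) auto
  also have "\<dots> = (\<integral>\<^sup>+h. \<integral>\<^sup>+x. \<Phi> (h, x) \<partial>distr M S X \<partial>distr M T H)"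
    unfolding eq[symmetric] using \<Phi>
    by (subst PX.nn_integral_fst[symmetric]) auto
  also have "\<dots> = (\<integral>\<^sup>+\<omega>. \<integral>\<^sup>+x. \<Phi> (H \<omega>, x) \<partial>distr M S X \<partial>M)"
    using HM \<Phi> by (subst nn_integral_distr) (auto intro!: PX.borel_measurable_nn_integral)
  also have "\<dots> = (\<integral>\<^sup>+\<omega>. \<integral>\<^sup>+\<omega>'. \<Phi> (H \<omega>, X \<omega>') \<partial>M \<partial>M)"
    using HM X \<Phi> by (intro nn_integral_cong, subst nn_integral_distr)
      (auto intro!: measurable_compose[OF _ \<Phi>] dest: measurable_space)
  finally show ?thesis .
qed

section \<open>Safe controls\<close>

lemma abs_scaleR_vec: "\<bar>c *\<^sub>R (u :: real^'m)\<bar> = \<bar>c\<bar> *\<^sub>R \<bar>u\<bar>"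
  by (simp add: vec_eq_iff abs_vec_def abs_mult)

lemma continuous_on_abs_vec [continuous_intros]:
  assumes "continuous_on S f"
  shows "continuous_on S (\<lambda>x. \<bar>f x :: real^'m\<bar>)"
  unfolding eucl_abs[where 'a = "real^'m"] using assms by (intro continuous_intros)

lemma borel_measurable_abs_vec [measurable (raw)]:
  assumes "f \<in> borel_measurable S"
  shows "(\<lambda>x. \<bar>f x :: real^'m\<bar>) \<in> borel_measurable S"
  by (rule measurable_compose[OF assms])
     (intro borel_measurable_continuous_onI continuous_intros)

text \<open>A real \<open>SUP\<close> is meaningful only on bounded nonempty sets. Compactness
  settles this once; afterwards worst-case conditions are inequalities for single returns.\<close>

lemma worst_loss_le_iff:
  assumes "compact K" "K \<noteq> {}"
  shows "worst_loss \<epsilon> K u \<le> c \<longleftrightarrow> (\<forall>x\<in>K. \<epsilon> \<bullet> \<bar>u\<bar> - u \<bullet> x \<le> c)"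
proof -
  have "bdd_above ((\<lambda>x. - u \<bullet> x) ` K)"
    using assms by (intro bounded_imp_bdd_above compact_imp_bounded compact_continuous_image continuous_intros)
  then have "support_fun K (- u) \<le> c - \<epsilon> \<bullet> \<bar>u\<bar> \<longleftrightarrow> (\<forall>x\<in>K. - u \<bullet> x \<le> c - \<epsilon> \<bullet> \<bar>u\<bar>)"
    unfolding support_fun_def using assms by (intro cSUP_le_iff) auto
  then show ?thesis
    by (auto simp: worst_loss_def algebra_simps)
qed

lemma zero_in_Gam: "\<lbrakk>compact K; K \<noteq> {}\<rbrakk> \<Longrightarrow> 0 \<in> Gam \<epsilon> K"
  by (simp add: Gam_def worst_loss_le_iff)

text \<open>Closed as an intersection of closed conditions, one per return. Bounded because the
  worst loss is positively homogeneous with a positive minimum on the unit sphere.\<close>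

lemma compact_Gam:
  fixes K :: "(real^'m) set"
  assumes K: "compact K" "K \<noteq> {}" and pos: "\<And>u. u \<noteq> 0 \<Longrightarrow> 0 < worst_loss \<epsilon> K u"
  shows "compact (Gam \<epsilon> K)"
proof -
  have "Gam \<epsilon> K = (\<Inter>x\<in>K. {u. \<epsilon> \<bullet> \<bar>u\<bar> - u \<bullet> x \<le> 1})"
    by (auto simp: Gam_def worst_loss_le_iff[OF K])
  moreover have "closed {u. \<epsilon> \<bullet> \<bar>u\<bar> - u \<bullet> x \<le> 1}" for x
    by (intro closed_Collect_le continuous_intros)
  ultimately have "closed (Gam \<epsilon> K)" by auto
  have ne: "sphere (0 :: real^'m) 1 \<noteq> {}" by simp
  have "continuous_on (sphere 0 1) (\<lambda>u :: real^'m. (SUP x\<in>K. - u \<bullet> x) + \<epsilon> \<bullet> \<bar>u\<bar>)"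
    using K by (intro continuous_on_add continuous_on_SUP_compact)
      (auto intro!: continuous_intros simp: case_prod_beta)
  from continuous_attains_inf[OF compact_sphere ne this]
  obtain u0 :: "real^'m" where u0: "norm u0 = 1" "\<And>u. norm u = 1 \<Longrightarrow> worst_loss \<epsilon> K u0 \<le> worst_loss \<epsilon> K u"
    by (auto simp: worst_loss_def support_fun_def)
  \<comment> \<open>By homogeneity the worst loss of \<gamma> is at least
    \<open>c * norm \<gamma>\<close>; being at most 1, it confines \<gamma> to the ball of radius
    \<open>1 / c\<close>.\<close>
  define c where "c = worst_loss \<epsilon> K u0"
  have c: "0 < c" using u0(1) pos[of u0] unfolding c_def by force
  have "norm \<gamma> \<le> 1 / c" if \<gamma>: "\<gamma> \<in> Gam \<epsilon> K" for \<gamma>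
  proof (cases "\<gamma> = 0")
    case False
    define u where "u = (1 / norm \<gamma>) *\<^sub>R \<gamma>"
    have "\<epsilon> \<bullet> \<bar>u\<bar> - u \<bullet> x \<le> 1 / norm \<gamma>" if "x \<in> K" for x
    proof -
      have "\<epsilon> \<bullet> \<bar>\<gamma>\<bar> - \<gamma> \<bullet> x \<le> 1"
        using \<gamma> that by (simp add: Gam_def worst_loss_le_iff[OF K])
      then show ?thesis
        using False by (simp add: u_def abs_scaleR_vec divide_simps)
    qed
    then have "worst_loss \<epsilon> K u \<le> 1 / norm \<gamma>"
      by (simp add: worst_loss_le_iff[OF K])
    moreover have "c \<le> worst_loss \<epsilon> K u"
      unfolding c_def using False by (intro u0) (simp add: u_def)
    ultimately have "c \<le> 1 / norm \<gamma>" by linarith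
    then show ?thesis using c False by (simp add: field_simps)
  qed (use c in simp)
  then have "bounded (Gam \<epsilon> K)"
    by (auto simp: bounded_iff)
  with \<open>closed (Gam \<epsilon> K)\<close> show ?thesis
    by (simp add: compact_eq_bounded_closed)
qed

text \<open>The running maximum enforces the upper constraint, and at a new peak the drawdown is
  zero. Only the floor set by the old peak can be violated; it is positive as \<open>d < 1\<close>,
  so wealth above it is nonnegative.\<close>

lemma step_safe_iff:
  assumes "0 \<le> d" "d < 1" "(v, w) \<in> safe_set d"
  shows "step \<epsilon> u x (v, w) \<in> safe_set d \<longleftrightarrow> \<epsilon> \<bullet> \<bar>u\<bar> - u \<bullet> x \<le> v - (1 - d) * w"
proof -
  define v' where "v' = v + u \<bullet> x - \<epsilon> \<bullet> \<bar>u\<bar>"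
  have w: "0 < w" using assms by (simp add: safe_set_def)
  have "(v', max w v') \<in> safe_set d \<longleftrightarrow> (1 - d) * w \<le> v'"
  proof
    assume "(v', max w v') \<in> safe_set d"
    then have "(1 - d) * max w v' \<le> v'" by (simp add: safe_set_def)
    moreover have "(1 - d) * w \<le> (1 - d) * max w v'"
      using assms by (intro mult_left_mono) auto
    ultimately show "(1 - d) * w \<le> v'" by linarith
  next
    assume le: "(1 - d) * w \<le> v'"
    have "0 < (1 - d) * w" using assms w by simp
    then have "0 < v'" using le by linarith
    moreover from this have "(1 - d) * v' \<le> v'" using assms by (simp add: algebra_simps)
    ultimately show "(v', max w v') \<in> safe_set d"
      using le w by (auto simp: safe_set_def max_def)
  qed
  then show ?thesis
    by (auto simp: step_def Let_def v'_def)
qed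

text \<open>Safety against all returns says that the worst loss is at most the cushion
  \<open>v - (1 - d) * w\<close>; dividing by a positive cushion normalises the bound to 1.\<close>

lemma robustly_safe_control_iff:
  assumes "0 \<le> d" "d < 1" "(v, w) \<in> safe_set d" and K: "compact K" "K \<noteq> {}"
    and pos: "\<And>u. u \<noteq> 0 \<Longrightarrow> 0 < worst_loss \<epsilon> K u"
  shows "(\<forall>y\<in>K. step \<epsilon> u y (v, w) \<in> safe_set d) \<longleftrightarrow>
         (\<exists>\<gamma>\<in>Gam \<epsilon> K. u = (v - (1 - d) * w) *\<^sub>R \<gamma>)"
proof -
  define c where "c = v - (1 - d) * w"
  have c: "0 \<le> c" using assms by (simp add: c_def safe_set_def)
  have "(\<forall>y\<in>K. step \<epsilon> u y (v, w) \<in> safe_set d) \<longleftrightarrow> (\<forall>y\<in>K. \<epsilon> \<bullet> \<bar>u\<bar> - u \<bullet> y \<le> c)"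
    by (simp add: step_safe_iff[OF assms(1-3)] c_def)
  also have "\<dots> \<longleftrightarrow> (\<exists>\<gamma>\<in>Gam \<epsilon> K. u = c *\<^sub>R \<gamma>)"
  proof
    assume *: "\<forall>y\<in>K. \<epsilon> \<bullet> \<bar>u\<bar> - u \<bullet> y \<le> c"
    show "\<exists>\<gamma>\<in>Gam \<epsilon> K. u = c *\<^sub>R \<gamma>"
    proof (cases "c = 0")
      \<comment> \<open>On the floor there is nothing to divide by; positivity of the worst loss
        leaves only \<open>u = 0\<close>.\<close>
      case True
      then have "worst_loss \<epsilon> K u \<le> 0" using * by (simp add: worst_loss_le_iff[OF K])
      then have "u = 0" using pos[of u] by force
      then show ?thesis using zero_in_Gam[OF K] by auto
    next
      case False
      have "(1 / c) *\<^sub>R u \<in> Gam \<epsilon> K"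
        unfolding Gam_def mem_Collect_eq worst_loss_le_iff[OF K]
      proof
        fix y assume "y \<in> K"
        then have "\<epsilon> \<bullet> \<bar>u\<bar> - u \<bullet> y \<le> c" using * by blast
        then show "\<epsilon> \<bullet> \<bar>(1 / c) *\<^sub>R u\<bar> - (1 / c) *\<^sub>R u \<bullet> y \<le> 1"
          using False c by (simp add: abs_scaleR_vec divide_simps)
      qed
      then show ?thesis using False by (intro bexI[of _ "(1 / c) *\<^sub>R u"]) auto
    qed
  next
    assume "\<exists>\<gamma>\<in>Gam \<epsilon> K. u = c *\<^sub>R \<gamma>"
    then obtain \<gamma> where \<gamma>: "u = c *\<^sub>R \<gamma>" "\<And>y. y \<in> K \<Longrightarrow> \<epsilon> \<bullet> \<bar>\<gamma>\<bar> - \<gamma> \<bullet> y \<le> 1"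
      by (auto simp: Gam_def worst_loss_le_iff[OF K])
    show "\<forall>y\<in>K. \<epsilon> \<bullet> \<bar>u\<bar> - u \<bullet> y \<le> c"
    proof
      fix y assume "y \<in> K"
      then have "c * (\<epsilon> \<bullet> \<bar>\<gamma>\<bar> - \<gamma> \<bullet> y) \<le> c * 1"
        using c \<gamma>(2) by (intro mult_left_mono) auto
      then show "\<epsilon> \<bullet> \<bar>u\<bar> - u \<bullet> y \<le> c"
        using c by (simp add: \<gamma>(1) abs_scaleR_vec algebra_simps)
    qed
  qed
  finally show ?thesis unfolding c_def .
qed

text \<open>Nonnegativity of the cushion carries it through the absolute value in the cost;
  positivity of \<open>w\<close> carries \<open>w\<close> through the maximum.\<close>

lemma step_scaled:
  assumes "(v, w) \<in> safe_set d"
  shows "step \<epsilon> ((v - (1 - d) * w) *\<^sub>R \<gamma>) x (v, w) =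
         (w * v_plus \<epsilon> d (v / w) \<gamma> x, w * w_plus \<epsilon> d (v / w) \<gamma> x)"
proof -
  have w: "0 < w" and c: "0 \<le> v - (1 - d) * w"
    using assms by (auto simp: safe_set_def)
  have v: "v + ((v - (1 - d) * w) *\<^sub>R \<gamma>) \<bullet> x - \<epsilon> \<bullet> \<bar>(v - (1 - d) * w) *\<^sub>R \<gamma>\<bar> =
      w * v_plus \<epsilon> d (v / w) \<gamma> x"
  proof -
    define c where "c = v - (1 - d) * w"
    have "w * (v / w - (1 - d)) = c"
      using w by (simp add: c_def field_simps)
    then have "w * v_plus \<epsilon> d (v / w) \<gamma> x = v + c * (\<gamma> \<bullet> x - \<epsilon> \<bullet> \<bar>\<gamma>\<bar>)"
      using w by (simp add: v_plus_def distrib_left mult.assoc[symmetric])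
    then show ?thesis
      using c unfolding c_def[symmetric] by (simp add: abs_scaleR_vec algebra_simps)
  qed
  have "max w (w * r) = w * max 1 r" for r
    using w by (auto simp: max_def)
  then show ?thesis
    unfolding step_def w_plus_def by (simp only: v Let_def prod.case)
qed

lemma w_plus_ge_1: "1 \<le> w_plus \<epsilon> d z \<gamma> x"
  by (simp add: w_plus_def)

text \<open>An admissible \<gamma> loses at most the whole cushion, and a new peak has ratio
  1.\<close>

lemma z_plus_mem:
  assumes "0 \<le> d" "z \<in> {1 - d..1}" "\<gamma> \<in> Gam \<epsilon> K" "x \<in> K" "compact K"
  shows "z_plus \<epsilon> d z \<gamma> x \<in> {1 - d..1}"
proof -
  have "\<epsilon> \<bullet> \<bar>\<gamma>\<bar> - \<gamma> \<bullet> x \<le> 1"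
    using assms worst_loss_le_iff[of K \<epsilon> \<gamma> 1] by (auto simp: Gam_def)
  then have "(z - (1 - d)) * (\<epsilon> \<bullet> \<bar>\<gamma>\<bar> - \<gamma> \<bullet> x) \<le> (z - (1 - d)) * 1"
    using assms by (intro mult_left_mono) auto
  then have "1 - d \<le> v_plus \<epsilon> d z \<gamma> x"
    by (simp add: v_plus_def algebra_simps)
  then show ?thesis
    using assms(1) by (auto simp: z_plus_def w_plus_def max_def)
qed

lemma safe_ratio_mem: "(v, w) \<in> safe_set d \<Longrightarrow> v / w \<in> {1 - d..1}"
  by (auto simp: safe_set_def field_simps)

section \<open>Regularity of the reduced dynamics\<close>

lemma continuous_on_w_plus [continuous_intros]:
  assumes "continuous_on S f" "continuous_on S g" "continuous_on S h"
  shows "continuous_on S (\<lambda>p. w_plus \<epsilon> d (f p) (g p) (h p))"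
  unfolding w_plus_def v_plus_def by (intro continuous_intros assms)

lemma continuous_on_z_plus [continuous_intros]:
  assumes "continuous_on S f" "continuous_on S g" "continuous_on S h"
  shows "continuous_on S (\<lambda>p. z_plus \<epsilon> d (f p) (g p) (h p))"
  unfolding z_plus_def
proof (intro continuous_on_divide continuous_on_w_plus assms)
  show "continuous_on S (\<lambda>p. v_plus \<epsilon> d (f p) (g p) (h p))"
    unfolding v_plus_def by (intro continuous_intros assms)
  show "\<forall>p\<in>S. w_plus \<epsilon> d (f p) (g p) (h p) \<noteq> 0"
    using w_plus_ge_1 by (metis not_one_le_zero)
qed

lemma borel_measurable_w_plus [measurable]: "w_plus \<epsilon> d z \<gamma> \<in> borel_measurable borel"
  by (intro borel_measurable_continuous_onI continuous_on_w_plus continuous_intros)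

lemma borel_measurable_z_plus [measurable]: "z_plus \<epsilon> d z \<gamma> \<in> borel_measurable borel"
  by (intro borel_measurable_continuous_onI continuous_on_z_plus continuous_intros)

section \<open>The Bellman recursion\<close>

locale drawdown_control = prob_space M for M :: "'a measure" +
  fixes X :: "nat \<Rightarrow> 'a \<Rightarrow> real^'m" and \<X> :: "nat \<Rightarrow> (real^'m) set"
    and \<epsilon> :: "real^'m" and d :: real and N :: nat
  assumes d: "0 \<le> d" "d < 1"
    and ne: "\<And>k. k < N \<Longrightarrow> \<X> k \<noteq> {}" and cpt: "\<And>k. k < N \<Longrightarrow> compact (\<X> k)"
    and X [measurable]: "\<And>k. k < N \<Longrightarrow> X k \<in> borel_measurable M"
    and supp: "\<And>k. k < N \<Longrightarrow> AE \<omega> in M. X k \<omega> \<in> \<X> k"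
    and pos: "\<And>k u. \<lbrakk>k < N; u \<noteq> 0\<rbrakk> \<Longrightarrow> 0 < worst_loss \<epsilon> (\<X> k) u"
    and indep: "\<And>k. k < N \<Longrightarrow>
      indep_set {X k -` A \<inter> space M | A. A \<in> sets borel} (sets (past_algebra M X k))"
begin

abbreviation "\<Gamma> k \<equiv> Gam \<epsilon> (\<X> k)"
abbreviation "Q k F \<equiv> bellman_objective M (X k) \<epsilon> d F"
abbreviation "Jv \<equiv> J M X \<epsilon> d \<X> N"
abbreviation "I \<equiv> {1 - d..1}"

lemma Gam_props: "k < N \<Longrightarrow> compact (\<Gamma> k)" "k < N \<Longrightarrow> 0 \<in> \<Gamma> k"
  by (rule compact_Gam[OF cpt ne pos]; assumption) (rule zero_in_Gam[OF cpt ne])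

text \<open>The bracketing separates the parameter (z, \<gamma>) from the return to be integrated
  out. Continuity of \<open>F\<close> on \<open>I\<close> suffices because admissible controls keep
  the next ratio in \<open>I\<close>.\<close>

lemma continuous_on_integrand:
  assumes "k < N" "continuous_on I F"
  shows "continuous_on ((I \<times> \<Gamma> k) \<times> \<X> k)
    (\<lambda>(p, x). w_plus \<epsilon> d (fst p) (snd p) x * F (z_plus \<epsilon> d (fst p) (snd p) x))"
  unfolding case_prod_beta
proof (intro continuous_on_mult continuous_on_w_plus continuous_intros)
  have "continuous_on ((I \<times> \<Gamma> k) \<times> \<X> k) (\<lambda>q. z_plus \<epsilon> d (fst (fst q)) (snd (fst q)) (snd q))"
    by (intro continuous_intros)
  then show "continuous_on ((I \<times> \<Gamma> k) \<times> \<X> k) (\<lambda>q. F (z_plus \<epsilon> d (fst (fst q)) (snd (fst q)) (snd q)))"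
    by (rule continuous_on_compose2[OF assms(2)])
       (use assms d cpt in \<open>auto intro: z_plus_mem simp del: atLeastAtMost_iff\<close>)
qed

text \<open>On the null event outside \<open>\<X> k\<close> the next ratio may leave
  \<open>I\<close>, so \<open>F\<close> has to be Borel on the whole line.\<close>

lemma measurable_integrand:
  assumes "k < N" "F \<in> borel_measurable borel"
  shows "(\<lambda>\<omega>. w_plus \<epsilon> d z \<gamma> (X k \<omega>) * F (z_plus \<epsilon> d z \<gamma> (X k \<omega>))) \<in> borel_measurable M"
  by (intro borel_measurable_times measurable_compose[OF X[OF assms(1)]]
      measurable_compose[OF _ assms(2)] borel_measurable_w_plus borel_measurable_z_plus)

lemma integrable_integrand:
  assumes "k < N" "F \<in> borel_measurable borel" "continuous_on I F" "z \<in> I" "\<gamma> \<in> \<Gamma> k"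
  shows "integrable M (\<lambda>\<omega>. w_plus \<epsilon> d z \<gamma> (X k \<omega>) * F (z_plus \<epsilon> d z \<gamma> (X k \<omega>)))"
proof -
  have "continuous_on (\<X> k) (\<lambda>x. w_plus \<epsilon> d z \<gamma> x * F (z_plus \<epsilon> d z \<gamma> x))"
    using continuous_on_slice(2)[OF continuous_on_integrand[OF assms(1,3)], of "(z, \<gamma>)"] assms by simp
  then have "bounded ((\<lambda>x. w_plus \<epsilon> d z \<gamma> x * F (z_plus \<epsilon> d z \<gamma> x)) ` \<X> k)"
    using cpt[OF assms(1)] by (intro compact_imp_bounded compact_continuous_image)
  then obtain C where "\<And>x. x \<in> \<X> k \<Longrightarrow> norm (w_plus \<epsilon> d z \<gamma> x * F (z_plus \<epsilon> d z \<gamma> x)) \<le> C"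
    unfolding bounded_iff by blast
  with supp[OF assms(1)] measurable_integrand[OF assms(1,2)] show ?thesis
    by (intro integrable_const_bound[of _ C]) auto
qed

lemma continuous_on_bellman_objective:
  assumes "k < N" "F \<in> borel_measurable borel" "continuous_on I F"
  shows "continuous_on (I \<times> \<Gamma> k) (\<lambda>(z, \<gamma>). Q k F z \<gamma>)"
  unfolding bellman_objective_def case_prod_beta
  using assms Gam_props cpt
  by (intro continuous_on_integral_compact[OF _ _ continuous_on_integrand supp] compact_Times
      measurable_integrand) auto

lemma bellman_objective_nonneg:
  assumes "k < N" "\<And>z. z \<in> I \<Longrightarrow> 0 \<le> F z" "z \<in> I" "\<gamma> \<in> \<Gamma> k"
  shows "0 \<le> Q k F z \<gamma>"
  unfolding bellman_objective_def
proof (rule integral_nonneg_AE)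
  show "AE \<omega> in M. 0 \<le> w_plus \<epsilon> d z \<gamma> (X k \<omega>) * F (z_plus \<epsilon> d z \<gamma> (X k \<omega>))"
    using supp[OF assms(1)]
  proof eventually_elim
    case (elim \<omega>)
    have "0 \<le> F (z_plus \<epsilon> d z \<gamma> (X k \<omega>))"
      using assms elim d cpt by (intro assms(2) z_plus_mem) auto
    then show ?case
      using w_plus_ge_1[of \<epsilon> d z \<gamma> "X k \<omega>"] by simp
  qed
qed

section \<open>Regularity of the value functions\<close>

lemma J_N: "Jv N = (\<lambda>z. z)"
  by (simp add: J.simps)

lemma J_unfold: "\<lbrakk>k < N; z \<in> I\<rbrakk> \<Longrightarrow> Jv k z = (SUP \<gamma>\<in>\<Gamma> k. Q k (Jv (Suc k)) z \<gamma>)"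
  by (subst J.simps) simp

lemma J_outside: "\<lbrakk>k < N; z \<notin> I\<rbrakk> \<Longrightarrow> Jv k z = 0"
  by (subst J.simps) auto

text \<open>The backward induction carries three properties together: continuity for attained
  suprema, measurability for the next expectation, nonnegativity for integration in
  \<open>ennreal\<close>.\<close>

lemma J_regular:
  assumes "k \<le> N"
  shows "continuous_on I (Jv k) \<and> Jv k \<in> borel_measurable borel \<and> (\<forall>z\<in>I. 0 \<le> Jv k z)"
  using assms
proof (induction rule: inc_induct)
  case base
  show ?case using d by (auto simp: J_N)
next
  case (step k)
  then have k: "k < N" and F: "continuous_on I (Jv (Suc k))" "Jv (Suc k) \<in> borel_measurable borel"
    "\<And>z. z \<in> I \<Longrightarrow> 0 \<le> Jv (Suc k) z" by auto
  note Q = continuous_on_bellman_objective[OF k F(2,1)]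
  have "continuous_on I (\<lambda>z. SUP \<gamma>\<in>\<Gamma> k. Q k (Jv (Suc k)) z \<gamma>)"
    using Q Gam_props[OF k] by (intro continuous_on_SUP_compact) auto
  then have c: "continuous_on I (Jv k)"
    by (subst continuous_on_cong[OF refl J_unfold[OF k]])
  \<comment> \<open>The zero extension turns continuity on \<open>I\<close> into Borel measurability
    on the line.\<close>
  have "Jv k = (\<lambda>z. indicator I z *\<^sub>R Jv k z)"
    using J_outside[OF k] by (auto simp: fun_eq_iff indicator_def)
  then have m: "Jv k \<in> borel_measurable borel"
    using borel_measurable_continuous_on_indicator[OF _ c] by (metis atLeastAtMost_borel)
  have "0 \<le> Jv k z" if z: "z \<in> I" for z
  proof -
    have "bdd_above (Q k (Jv (Suc k)) z ` \<Gamma> k)"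
      using continuous_on_slice(2)[OF Q z] Gam_props[OF k]
      by (intro bounded_imp_bdd_above compact_imp_bounded compact_continuous_image) auto
    \<comment> \<open>The zero control is always admissible and bounds the supremum from
      below.\<close>
    then have "Q k (Jv (Suc k)) z 0 \<le> Jv k z"
      unfolding J_unfold[OF k z] using Gam_props[OF k] by (intro cSUP_upper) auto
    moreover have "0 \<le> Q k (Jv (Suc k)) z 0"
      using bellman_objective_nonneg[OF k F(3) z] Gam_props[OF k] by auto
    ultimately show ?thesis by linarith
  qed
  with c m show ?case by blast
qed

lemmas J_cont = J_regular[THEN conjunct1]
lemmas J_borel = J_regular[THEN conjunct2, THEN conjunct1]
lemmas J_nonneg = J_regular[THEN conjunct2, THEN conjunct2, rule_format]

lemma bellman_objective_le_J:
  assumes k: "k < N" and z: "z \<in> I" and "\<gamma> \<in> \<Gamma> k"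
  shows "Q k (Jv (Suc k)) z \<gamma> \<le> Jv k z"
proof -
  have "continuous_on (\<Gamma> k) (Q k (Jv (Suc k)) z)"
    using k by (intro continuous_on_slice(2)[OF continuous_on_bellman_objective z] J_borel J_cont) auto
  then have "bdd_above (Q k (Jv (Suc k)) z ` \<Gamma> k)"
    using Gam_props[OF k]
    by (intro bounded_imp_bdd_above compact_imp_bounded compact_continuous_image) auto
  then show ?thesis
    unfolding J_unfold[OF k z] using assms by (intro cSUP_upper) auto
qed

lemma bellman_selector_exists:
  assumes k: "k < N"
  shows "\<exists>\<gamma>. bellman_selector M X \<epsilon> d \<X> N k \<gamma>"
proof -
  have Q: "continuous_on (I \<times> \<Gamma> k) (\<lambda>(z, \<gamma>). Q k (Jv (Suc k)) z \<gamma>)"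
    using k by (intro continuous_on_bellman_objective J_borel J_cont) auto
  obtain g where g: "g \<in> restrict_space borel I \<rightarrow>\<^sub>M restrict_space borel (\<Gamma> k)"
    and opt: "\<And>z \<gamma>. \<lbrakk>z \<in> I; \<gamma> \<in> \<Gamma> k\<rbrakk> \<Longrightarrow> Q k (Jv (Suc k)) z \<gamma> \<le> Q k (Jv (Suc k)) z (g z)"
    by (rule measurable_argmax[OF compact_Icc Gam_props(1)[OF k] _ Q]) (use Gam_props[OF k] in auto)
  have "g z \<in> \<Gamma> k" if "z \<in> I" for z
    using measurable_space[OF g, of z] that by (simp add: space_restrict_space)
  then have "Q k (Jv (Suc k)) z (g z) = Jv k z" if "z \<in> I" for z
    unfolding J_unfold[OF k that] using that opt by (intro cSup_eq_maximum[symmetric]) auto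
  with g opt show ?thesis
    unfolding bellman_selector_def by blast
qed

end

section \<open>Policies and the closed loop\<close>

lemma run_before: "j \<le> k \<Longrightarrow> run \<epsilon> U k s x j = s"
  by (induction j) auto

text \<open>The two laws need to agree only at states visited by the second one. This allows
  exchanging a feedback law for another that coincides with it merely on safe states.\<close>

lemma run_cong:
  assumes "\<And>i. i < j \<Longrightarrow> x i = x' i"
    and "\<And>i. \<lbrakk>k \<le> i; i < j\<rbrakk> \<Longrightarrow> U i (run \<epsilon> U' k s x' i) = U' i (run \<epsilon> U' k s x' i)"
  shows "run \<epsilon> U k s x j = run \<epsilon> U' k s x' j"
  using assms by (induction j) auto

lemma run_safe:
  assumes "s \<in> safe_set d"
    and "\<And>j. \<lbrakk>k \<le> j; j < n; run \<epsilon> U k s x j \<in> safe_set d\<rbrakk>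
      \<Longrightarrow> step \<epsilon> (U j (run \<epsilon> U k s x j)) (x j) (run \<epsilon> U k s x j) \<in> safe_set d"
  shows "run \<epsilon> U k s x n \<in> safe_set d"
  using assms by (induction n) auto

lemma measurable_step:
  assumes u: "u \<in> F \<rightarrow>\<^sub>M borel" and x: "x \<in> F \<rightarrow>\<^sub>M borel" and s: "s \<in> F \<rightarrow>\<^sub>M borel"
  shows "(\<lambda>\<omega>. step \<epsilon> (u \<omega>) (x \<omega>) (s \<omega>) :: real \<times> real) \<in> F \<rightarrow>\<^sub>M borel"
proof -
  have [measurable]: "(\<lambda>\<omega>. fst (s \<omega>)) \<in> F \<rightarrow>\<^sub>M borel" "(\<lambda>\<omega>. snd (s \<omega>)) \<in> F \<rightarrow>\<^sub>M borel"
    by (intro measurable_compose[OF s] borel_measurable_continuous_onI continuous_intros)+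
  note [measurable] = u x
  show ?thesis
    unfolding step_def Let_def case_prod_beta by (intro borel_measurable_Pair) measurable
qed

lemma measurable_run:
  assumes "\<And>i. \<lbrakk>k \<le> i; i < j\<rbrakk> \<Longrightarrow> U i \<in> borel \<rightarrow>\<^sub>M borel"
    and "\<And>i. i < j \<Longrightarrow> Y i \<in> F \<rightarrow>\<^sub>M borel"
  shows "(\<lambda>\<omega>. run \<epsilon> U k s (\<lambda>i. Y i \<omega>) j) \<in> F \<rightarrow>\<^sub>M borel"
  using assms
proof (induction j)
  case (Suc j)
  then have "(\<lambda>\<omega>. run \<epsilon> U k s (\<lambda>i. Y i \<omega>) j) \<in> F \<rightarrow>\<^sub>M borel" by simp
  with Suc.prems show ?case
    by (cases "j < k") (auto intro!: measurable_step intro: measurable_compose)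
qed simp

section \<open>Feedback laws as causal policies\<close>

lemma feedback_eq:
  assumes "(v, w) \<in> safe_set d"
  shows "feedback d \<gamma> k (v, w) = (v - (1 - d) * w) *\<^sub>R \<gamma> k (v / w)"
proof -
  have "w * (v / w - (1 - d)) = v - (1 - d) * w"
    using assms by (auto simp: safe_set_def field_simps)
  then show ?thesis by (simp add: feedback_def)
qed

lemma measurable_feedback:
  assumes "\<gamma> k \<in> borel \<rightarrow>\<^sub>M borel"
  shows "feedback d \<gamma> k \<in> borel \<rightarrow>\<^sub>M borel"
proof -
  have [measurable]: "(\<lambda>s :: real \<times> real. fst s) \<in> borel \<rightarrow>\<^sub>M borel"
    "(\<lambda>s :: real \<times> real. snd s) \<in> borel \<rightarrow>\<^sub>M borel"
    by (intro borel_measurable_continuous_onI continuous_intros)+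
  note [measurable] = assms
  show ?thesis
    unfolding feedback_def case_prod_beta by measurable
qed

text \<open>A run up to stage \<open>j\<close> reads only returns before \<open>j\<close>, so
  truncating the path loses nothing, and on admissible paths \<open>control\<close> does not fall
  back to its default.\<close>

lemma control_feedback_policy:
  assumes "\<And>i. i < j \<Longrightarrow> x i \<in> \<X> i"
  shows "control \<X> (feedback_policy \<epsilon> d \<gamma> k s) j x = feedback d \<gamma> j (run \<epsilon> (feedback d \<gamma>) k s x j)"
proof -
  have "restrict x {..<j} \<in> (\<Pi>\<^sub>E i\<in>{..<j}. \<X> i)"
    using assms by auto
  moreover have "run \<epsilon> (feedback d \<gamma>) k s (restrict x {..<j}) j = run \<epsilon> (feedback d \<gamma>) k s x j"
    by (rule run_cong) auto
  ultimately show ?thesis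
    by (simp add: control_def feedback_policy_def)
qed

lemma policy_state_feedback_policy:
  assumes "\<And>i. i < j \<Longrightarrow> x i \<in> \<X> i"
  shows "policy_state \<epsilon> \<X> (feedback_policy \<epsilon> d \<gamma> k s) k s x j = run \<epsilon> (feedback d \<gamma>) k s x j"
  unfolding policy_state_def using assms by (intro run_cong control_feedback_policy) auto

section \<open>Measurability with respect to past returns\<close>

lemma space_past_algebra [simp]: "space (past_algebra M X k) = space M"
  by (simp add: past_algebra_def space_measure_of_conv)

lemma sets_past_algebra:
  "sets (past_algebra M X k) =
    sigma_sets (space M) (\<Union>i<k. {X i -` A \<inter> space M | A. A \<in> sets borel})"
  unfolding past_algebra_def by (rule sets_measure_of) auto

lemma subalgebra_past_algebra_mono: "j \<le> k \<Longrightarrow> subalgebra (past_algebra M X k) (past_algebra M X j)"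
  unfolding subalgebra_def sets_past_algebra space_past_algebra
  by (intro conjI refl sigma_sets_mono' UN_mono) auto

lemma subalgebra_past_algebra:
  assumes "\<And>i. i < k \<Longrightarrow> X i \<in> borel_measurable M"
  shows "subalgebra M (past_algebra M X k)"
  unfolding subalgebra_def sets_past_algebra space_past_algebra
  using assms by (intro conjI refl sets.sigma_sets_subset) (auto intro: measurable_sets)

lemma measurable_past_algebra:
  assumes "i < k"
  shows "X i \<in> past_algebra M X k \<rightarrow>\<^sub>M borel"
proof (rule measurableI)
  fix A :: "(real^'b) set" assume "A \<in> sets borel"
  then show "X i -` A \<inter> space (past_algebra M X k) \<in> sets (past_algebra M X k)"
    unfolding sets_past_algebra space_past_algebra using assms by (intro sigma_sets.Basic) auto
qed simp

text \<open>The decision rule is measurable only on its domain \<open>E\<close>. Whether the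
  observed returns lie in \<open>E\<close> is itself an event of the past, so the rule on
  \<open>E\<close> and the default 0 off \<open>E\<close> glue measurably.\<close>

lemma measurable_control:
  assumes \<pi>: "\<pi> \<in> causal_policies \<X> N k" and j: "k \<le> j" "j < N"
    and \<X>: "\<And>i. i < N \<Longrightarrow> \<X> i \<in> sets borel"
  shows "(\<lambda>\<omega>. control \<X> \<pi> j (\<lambda>i. X i \<omega>)) \<in> past_algebra M X j \<rightarrow>\<^sub>M borel"
proof -
  let ?F = "past_algebra M X j"
  define R where "R \<omega> = (\<lambda>i\<in>{..<j}. X i \<omega>)" for \<omega>
  define E where "E = (\<Pi>\<^sub>E i\<in>{..<j}. \<X> i)"
  have R: "R \<in> ?F \<rightarrow>\<^sub>M (\<Pi>\<^sub>M i\<in>{..<j}. borel)"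
    unfolding R_def by (intro measurable_restrict measurable_past_algebra) auto
  have "E \<in> sets (\<Pi>\<^sub>M i\<in>{..<j}. borel)"
    unfolding E_def using \<X> j by (intro sets_PiM_I_finite) auto
  then have set: "{\<omega> \<in> space ?F. R \<omega> \<in> E} \<in> sets ?F"
    using measurable_sets[OF R, of E] by (simp add: vimage_def Int_def conj_commute)
  have "(\<lambda>\<omega>. \<lambda>i\<in>{..<j}. X i \<omega>) \<in> restrict_space ?F {\<omega>. R \<omega> \<in> E}
      \<rightarrow>\<^sub>M (\<Pi>\<^sub>M i\<in>{..<j}. restrict_space borel (\<X> i))"
    by (intro measurable_restrict measurable_restrict_space2 measurable_restrict_space1
        measurable_past_algebra) (auto simp: space_restrict_space R_def E_def PiE_iff)
  moreover have "\<pi> j \<in> (\<Pi>\<^sub>M i\<in>{..<j}. restrict_space borel (\<X> i)) \<rightarrow>\<^sub>M borel"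
    using \<pi> j by (simp add: causal_policies_def)
  ultimately have "(\<lambda>\<omega>. \<pi> j (R \<omega>)) \<in> restrict_space ?F {\<omega>. R \<omega> \<in> E} \<rightarrow>\<^sub>M borel"
    unfolding R_def by (rule measurable_compose)
  then have "(\<lambda>\<omega>. if R \<omega> \<in> E then \<pi> j (R \<omega>) else 0) \<in> ?F \<rightarrow>\<^sub>M borel"
    using set by (subst measurable_If_restrict_space_iff) auto
  then show ?thesis
    unfolding control_def R_def E_def .
qed

text \<open>The state at stage \<open>j\<close> depends on returns strictly before \<open>j\<close>;
  this later makes it independent of \<open>X j\<close>.\<close>

lemma measurable_policy_state:
  assumes \<pi>: "\<pi> \<in> causal_policies \<X> N k" and "j \<le> N"
    and \<X>: "\<And>i. i < N \<Longrightarrow> \<X> i \<in> sets borel"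
  shows "(\<lambda>\<omega>. policy_state \<epsilon> \<X> \<pi> k s (\<lambda>i. X i \<omega>) j) \<in> past_algebra M X j \<rightarrow>\<^sub>M borel"
  using assms(2)
proof (induction j)
  case (Suc j)
  note mono = measurable_from_subalg[OF subalgebra_past_algebra_mono[of j "Suc j"]]
  have "(\<lambda>\<omega>. policy_state \<epsilon> \<X> \<pi> k s (\<lambda>i. X i \<omega>) j) \<in> past_algebra M X (Suc j) \<rightarrow>\<^sub>M borel"
    using Suc by (intro mono) auto
  moreover have "(\<lambda>\<omega>. control \<X> \<pi> j (\<lambda>i. X i \<omega>)) \<in> past_algebra M X (Suc j) \<rightarrow>\<^sub>M borel" if "k \<le> j"
    using Suc.prems that by (intro mono measurable_control[OF \<pi>] \<X>) auto
  ultimately show ?case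
    by (cases "j < k") (auto simp: policy_state_def intro!: measurable_step measurable_past_algebra)
qed (simp add: policy_state_def)

section \<open>Dynamic programming\<close>

context drawdown_control
begin

lemma borel_returns: "k < N \<Longrightarrow> \<X> k \<in> sets borel"
  by (intro borel_closed compact_imp_closed cpt)

lemma past_sub: "k \<le> N \<Longrightarrow> subalgebra M (past_algebra M X k)"
  by (intro subalgebra_past_algebra X) auto

lemma AE_returns: "AE \<omega> in M. \<forall>i<N. X i \<omega> \<in> \<X> i"
proof -
  have "AE \<omega> in M. \<forall>i\<in>{..<N}. X i \<omega> \<in> \<X> i"
    using supp by (intro AE_finite_allI) auto
  then show ?thesis by eventually_elim auto
qed

text \<open>Truncation of negative numbers by \<open>ennreal\<close> is harmless: on safe states the
  product is nonnegative.\<close>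

definition val :: "nat \<Rightarrow> real \<times> real \<Rightarrow> ennreal" where
  "val k s = ennreal (snd s * Jv k (fst s / snd s))"

lemma measurable_val:
  assumes "k \<le> N"
  shows "val k \<in> borel \<rightarrow>\<^sub>M borel"
proof -
  have [measurable]: "(\<lambda>s :: real \<times> real. fst s) \<in> borel \<rightarrow>\<^sub>M borel"
    "(\<lambda>s :: real \<times> real. snd s) \<in> borel \<rightarrow>\<^sub>M borel"
    by (intro borel_measurable_continuous_onI continuous_intros)+
  note [measurable] = J_borel[OF assms]
  show ?thesis unfolding val_def by measurable
qed

lemma val_N: "s \<in> safe_set d \<Longrightarrow> val N s = ennreal (fst s)"
  by (auto simp: val_def J_N safe_set_def)

text \<open>One stage from a fixed state: homogeneity pulls out \<open>w\<close>, and what remains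
  is the Bellman integrand. Its integrability and nonnegativity translate the nonnegative integral
  into the Bochner integral defining the recursion.\<close>

lemma nn_integral_val_step:
  assumes k: "k < N" and s: "(v, w) \<in> safe_set d" and \<gamma>: "\<gamma> \<in> \<Gamma> k"
  shows "(\<integral>\<^sup>+\<omega>. val (Suc k) (step \<epsilon> ((v - (1 - d) * w) *\<^sub>R \<gamma>) (X k \<omega>) (v, w)) \<partial>M) =
         ennreal (w * Q k (Jv (Suc k)) (v / w) \<gamma>)"
proof -
  have w: "0 < w" using s by (simp add: safe_set_def)
  let ?z = "v / w"
  let ?f = "\<lambda>\<omega>. w_plus \<epsilon> d ?z \<gamma> (X k \<omega>) * Jv (Suc k) (z_plus \<epsilon> d ?z \<gamma> (X k \<omega>))"
  have "(\<integral>\<^sup>+\<omega>. val (Suc k) (step \<epsilon> ((v - (1 - d) * w) *\<^sub>R \<gamma>) (X k \<omega>) (v, w)) \<partial>M) =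
      (\<integral>\<^sup>+\<omega>. ennreal (w * ?f \<omega>) \<partial>M)"
    using w by (simp add: step_scaled[OF s] val_def z_plus_def mult.assoc)
  also have "\<dots> = ennreal (\<integral>\<omega>. w * ?f \<omega> \<partial>M)"
  proof (rule nn_integral_eq_integral)
    show "integrable M (\<lambda>\<omega>. w * ?f \<omega>)"
      using k \<gamma> safe_ratio_mem[OF s]
      by (intro integrable_mult_right integrable_integrand J_borel J_cont) auto
    show "AE \<omega> in M. 0 \<le> w * ?f \<omega>"
      using supp[OF k]
    proof eventually_elim
      case (elim \<omega>)
      have "0 \<le> Jv (Suc k) (z_plus \<epsilon> d ?z \<gamma> (X k \<omega>))"
        using k by (intro J_nonneg z_plus_mem[OF d(1) safe_ratio_mem[OF s] \<gamma> elim] cpt) auto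
      then show ?case
        using w w_plus_ge_1[of \<epsilon> d ?z \<gamma> "X k \<omega>"] by simp
    qed
  qed
  also have "\<dots> = ennreal (w * Q k (Jv (Suc k)) ?z \<gamma>)"
    by (simp add: bellman_objective_def)
  finally show ?thesis .
qed

text \<open>Membership in \<open>safe_policies\<close> promises a safe successor only from a safe
  current state; starting in the safe set discharges this premise stage by stage.\<close>

lemma policy_state_safe:
  assumes \<pi>: "\<pi> \<in> safe_policies \<epsilon> d \<X> N k s" and s: "s \<in> safe_set d"
    and "j \<le> N" "\<And>i. i < j \<Longrightarrow> x i \<in> \<X> i"
  shows "policy_state \<epsilon> \<X> \<pi> k s x j \<in> safe_set d"
  unfolding policy_state_def
proof (rule run_safe[OF s])
  fix i assume "k \<le> i" "i < j" "run \<epsilon> (\<lambda>j t. control \<X> \<pi> j x) k s x i \<in> safe_set d"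
  with \<pi> assms(3,4) show "step \<epsilon> (control \<X> \<pi> i x) (x i) (run \<epsilon> (\<lambda>j t. control \<X> \<pi> j x) k s x i) \<in> safe_set d"
    unfolding safe_policies_def policy_state_def by simp
qed

lemma safe_control_scaled:
  assumes \<pi>: "\<pi> \<in> safe_policies \<epsilon> d \<X> N k s" and s: "s \<in> safe_set d"
    and j: "k \<le> j" "j < N" and x: "\<And>i. i < j \<Longrightarrow> x i \<in> \<X> i"
    and st: "policy_state \<epsilon> \<X> \<pi> k s x j = (v, w)"
  shows "\<exists>\<gamma>\<in>\<Gamma> j. control \<X> \<pi> j x = (v - (1 - d) * w) *\<^sub>R \<gamma>"
proof -
  have safe: "(v, w) \<in> safe_set d"
    using policy_state_safe[OF \<pi> s less_imp_le[OF j(2)] x] st by simp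
  have "\<forall>y\<in>\<X> j. step \<epsilon> (control \<X> \<pi> j x) y (v, w) \<in> safe_set d"
  proof
    fix y assume "y \<in> \<X> j"
    moreover have "\<forall>x. (\<forall>i<j. x i \<in> \<X> i) \<longrightarrow> policy_state \<epsilon> \<X> \<pi> k s x j \<in> safe_set d \<longrightarrow>
       (\<forall>y\<in>\<X> j. step \<epsilon> (control \<X> \<pi> j x) y (policy_state \<epsilon> \<X> \<pi> k s x j) \<in> safe_set d)"
      using \<pi> j unfolding safe_policies_def by simp
    ultimately show "step \<epsilon> (control \<X> \<pi> j x) y (v, w) \<in> safe_set d"
      using x safe st by metis
  qed
  moreover have "(\<forall>y\<in>\<X> j. step \<epsilon> (control \<X> \<pi> j x) y (v, w) \<in> safe_set d) \<longleftrightarrow>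
      (\<exists>\<gamma>\<in>\<Gamma> j. control \<X> \<pi> j x = (v - (1 - d) * w) *\<^sub>R \<gamma>)"
    by (rule robustly_safe_control_iff[OF d safe cpt[OF j(2)] ne[OF j(2)] pos[OF j(2)]])
  ultimately show ?thesis by (simp only:)
qed

text \<open>Common step of the upper bound and of optimality. \<open>\<gamma>\<close> may be any
  function of the path: it only rewrites the inner integral almost everywhere, while Fubini is
  applied to the control itself.\<close>

lemma nn_integral_val_Suc:
  assumes \<pi>: "\<pi> \<in> safe_policies \<epsilon> d \<X> N k s" and s: "s \<in> safe_set d" and j: "k \<le> j" "j < N"
    and \<gamma>: "\<And>x. (\<And>i. i < N \<Longrightarrow> x i \<in> \<X> i) \<Longrightarrow> \<gamma> x \<in> \<Gamma> j \<and>
      control \<X> \<pi> j x = (fst (policy_state \<epsilon> \<X> \<pi> k s x j) - (1 - d) * snd (policy_state \<epsilon> \<X> \<pi> k s x j)) *\<^sub>R \<gamma> x"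
  shows "(\<integral>\<^sup>+\<omega>. val (Suc j) (policy_state \<epsilon> \<X> \<pi> k s (\<lambda>i. X i \<omega>) (Suc j)) \<partial>M) =
    (\<integral>\<^sup>+\<omega>. (case policy_state \<epsilon> \<X> \<pi> k s (\<lambda>i. X i \<omega>) j of (v, w) \<Rightarrow>
       ennreal (w * Q j (Jv (Suc j)) (v / w) (\<gamma> (\<lambda>i. X i \<omega>)))) \<partial>M)"
proof -
  define S where "S \<omega> = policy_state \<epsilon> \<X> \<pi> k s (\<lambda>i. X i \<omega>) j" for \<omega>
  define u where "u \<omega> = control \<X> \<pi> j (\<lambda>i. X i \<omega>)" for \<omega>
  define \<Phi> where "\<Phi> = (\<lambda>(h, x). val (Suc j) (step \<epsilon> (snd h) x (fst h)))"
  have causal: "\<pi> \<in> causal_policies \<X> N k"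
    using \<pi> by (simp add: safe_policies_def)
  have S: "S \<in> past_algebra M X j \<rightarrow>\<^sub>M borel" and u: "u \<in> past_algebra M X j \<rightarrow>\<^sub>M borel"
    unfolding S_def u_def using j
    by (auto intro!: measurable_policy_state[OF causal] measurable_control[OF causal] borel_returns)
  have \<Phi>: "\<Phi> \<in> borel_measurable ((borel \<Otimes>\<^sub>M borel) \<Otimes>\<^sub>M borel)"
    unfolding \<Phi>_def case_prod_beta using j
    by (intro measurable_compose[OF measurable_step measurable_val]) auto
  have "(\<integral>\<^sup>+\<omega>. val (Suc j) (policy_state \<epsilon> \<X> \<pi> k s (\<lambda>i. X i \<omega>) (Suc j)) \<partial>M) =
      (\<integral>\<^sup>+\<omega>. \<Phi> ((S \<omega>, u \<omega>), X j \<omega>) \<partial>M)"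
    using j by (simp add: \<Phi>_def S_def u_def policy_state_def)
  \<comment> \<open>For fixed \<open>\<omega>\<close> the inner integral is now a one-stage
    expectation from a fixed state under a fixed control.\<close>
  also have "\<dots> = (\<integral>\<^sup>+\<omega>. \<integral>\<^sup>+\<omega>'. \<Phi> ((S \<omega>, u \<omega>), X j \<omega>') \<partial>M \<partial>M)"
    using j by (intro nn_integral_indep[OF indep past_sub X _ \<Phi>] measurable_Pair S u) auto
  also have "\<dots> = (\<integral>\<^sup>+\<omega>. (case S \<omega> of (v, w) \<Rightarrow>
       ennreal (w * Q j (Jv (Suc j)) (v / w) (\<gamma> (\<lambda>i. X i \<omega>)))) \<partial>M)"
  proof (rule nn_integral_cong_AE)
    show "AE \<omega> in M. (\<integral>\<^sup>+\<omega>'. \<Phi> ((S \<omega>, u \<omega>), X j \<omega>') \<partial>M) = (case S \<omega> of (v, w) \<Rightarrow>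
       ennreal (w * Q j (Jv (Suc j)) (v / w) (\<gamma> (\<lambda>i. X i \<omega>))))"
      using AE_returns
    proof eventually_elim
      case (elim \<omega>)
      obtain v w where vw: "S \<omega> = (v, w)" by fastforce
      have safe: "(v, w) \<in> safe_set d"
        using policy_state_safe[OF \<pi> s, of j "\<lambda>i. X i \<omega>"] elim j vw by (simp add: S_def)
      have "\<gamma> (\<lambda>i. X i \<omega>) \<in> \<Gamma> j" "u \<omega> = (v - (1 - d) * w) *\<^sub>R \<gamma> (\<lambda>i. X i \<omega>)"
        using \<gamma>[of "\<lambda>i. X i \<omega>"] elim vw by (simp_all add: S_def u_def)
      then show ?case
        using nn_integral_val_step[OF j(2) safe] vw by (simp add: \<Phi>_def)
    qed
  qed
  finally show ?thesis by (simp add: S_def)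
qed

text \<open>The supermartingale inequality in expectation. It starts with equality, since the state
  at stage \<open>k\<close> is the constant \<open>s\<close> and the total mass is 1.\<close>

lemma nn_integral_val_le:
  assumes \<pi>: "\<pi> \<in> safe_policies \<epsilon> d \<X> N k s" and s: "s \<in> safe_set d" and "k \<le> j" "j \<le> N"
  shows "(\<integral>\<^sup>+\<omega>. val j (policy_state \<epsilon> \<X> \<pi> k s (\<lambda>i. X i \<omega>) j) \<partial>M) \<le> val k s"
  using assms(3,4)
proof (induction rule: dec_induct)
  case base
  then show ?case by (simp add: policy_state_def run_before emeasure_space_1)
next
  case (step j)
  let ?S = "\<lambda>x. policy_state \<epsilon> \<X> \<pi> k s x j"
  have j: "k \<le> j" "j < N" using step by auto
  \<comment> \<open>A pathwise choice; on the floor several \<gamma> represent the same control, and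
    no measurable selection is attempted.\<close>
  have "\<exists>\<gamma>. \<forall>x. (\<forall>i<N. x i \<in> \<X> i) \<longrightarrow> \<gamma> x \<in> \<Gamma> j \<and>
      control \<X> \<pi> j x = (fst (?S x) - (1 - d) * snd (?S x)) *\<^sub>R \<gamma> x"
  proof (intro choice allI)
    fix x
    show "\<exists>g. (\<forall>i<N. x i \<in> \<X> i) \<longrightarrow> g \<in> \<Gamma> j \<and>
        control \<X> \<pi> j x = (fst (?S x) - (1 - d) * snd (?S x)) *\<^sub>R g"
      using safe_control_scaled[OF \<pi> s j, of x "fst (?S x)" "snd (?S x)"] j by fastforce
  qed
  then obtain \<gamma> where \<gamma>: "\<And>x. (\<And>i. i < N \<Longrightarrow> x i \<in> \<X> i) \<Longrightarrow> \<gamma> x \<in> \<Gamma> j \<and>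
      control \<X> \<pi> j x = (fst (?S x) - (1 - d) * snd (?S x)) *\<^sub>R \<gamma> x"
    by auto
  have "(\<integral>\<^sup>+\<omega>. val (Suc j) (policy_state \<epsilon> \<X> \<pi> k s (\<lambda>i. X i \<omega>) (Suc j)) \<partial>M) =
    (\<integral>\<^sup>+\<omega>. (case ?S (\<lambda>i. X i \<omega>) of (v, w) \<Rightarrow>
       ennreal (w * Q j (Jv (Suc j)) (v / w) (\<gamma> (\<lambda>i. X i \<omega>)))) \<partial>M)"
    by (rule nn_integral_val_Suc[OF \<pi> s j \<gamma>])
  also have "\<dots> \<le> (\<integral>\<^sup>+\<omega>. val j (?S (\<lambda>i. X i \<omega>)) \<partial>M)"
  proof (rule nn_integral_mono_AE)
    show "AE \<omega> in M. (case ?S (\<lambda>i. X i \<omega>) of (v, w) \<Rightarrow>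
        ennreal (w * Q j (Jv (Suc j)) (v / w) (\<gamma> (\<lambda>i. X i \<omega>)))) \<le> val j (?S (\<lambda>i. X i \<omega>))"
      using AE_returns
    proof eventually_elim
      case (elim \<omega>)
      obtain v w where vw: "?S (\<lambda>i. X i \<omega>) = (v, w)" by fastforce
      have safe: "(v, w) \<in> safe_set d"
        using policy_state_safe[OF \<pi> s, of j "\<lambda>i. X i \<omega>"] elim j vw by simp
      have "Q j (Jv (Suc j)) (v / w) (\<gamma> (\<lambda>i. X i \<omega>)) \<le> Jv j (v / w)"
        using \<gamma>[of "\<lambda>i. X i \<omega>"] elim
        by (intro bellman_objective_le_J j safe_ratio_mem[OF safe]) auto
      then show ?case
        using safe by (auto simp: vw val_def safe_set_def intro!: ennreal_leI mult_left_mono)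
    qed
  qed
  also have "\<dots> \<le> val k s" using step by simp
  finally show ?case .
qed

section \<open>From the value process to expected terminal wealth\<close>

lemma terminal_value_measurable:
  assumes "\<pi> \<in> causal_policies \<X> N k"
  shows "terminal_value X \<epsilon> \<X> N k s \<pi> \<in> borel_measurable M"
proof -
  have "(\<lambda>\<omega>. policy_state \<epsilon> \<X> \<pi> k s (\<lambda>i. X i \<omega>) N) \<in> M \<rightarrow>\<^sub>M borel"
    by (rule measurable_from_subalg[OF past_sub[OF order_refl] measurable_policy_state[OF assms order_refl borel_returns]])
  then show ?thesis
    unfolding terminal_value_def
    by (rule measurable_compose) (intro borel_measurable_continuous_onI continuous_intros)
qed

lemma terminal_value_nn_integral:
  assumes \<pi>: "\<pi> \<in> safe_policies \<epsilon> d \<X> N k s" and s: "s \<in> safe_set d"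
  shows "AE \<omega> in M. 0 \<le> terminal_value X \<epsilon> \<X> N k s \<pi> \<omega>"
    and "(\<integral>\<^sup>+\<omega>. ennreal (terminal_value X \<epsilon> \<X> N k s \<pi> \<omega>) \<partial>M) =
         (\<integral>\<^sup>+\<omega>. val N (policy_state \<epsilon> \<X> \<pi> k s (\<lambda>i. X i \<omega>) N) \<partial>M)"
proof -
  have safe: "AE \<omega> in M. policy_state \<epsilon> \<X> \<pi> k s (\<lambda>i. X i \<omega>) N \<in> safe_set d"
    using AE_returns by eventually_elim (auto intro: policy_state_safe[OF \<pi> s])
  then show "AE \<omega> in M. 0 \<le> terminal_value X \<epsilon> \<X> N k s \<pi> \<omega>"
    by eventually_elim (auto simp: terminal_value_def safe_set_def)
  show "(\<integral>\<^sup>+\<omega>. ennreal (terminal_value X \<epsilon> \<X> N k s \<pi> \<omega>) \<partial>M) =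
         (\<integral>\<^sup>+\<omega>. val N (policy_state \<epsilon> \<X> \<pi> k s (\<lambda>i. X i \<omega>) N) \<partial>M)"
    using safe by (intro nn_integral_cong_AE) (auto simp: val_N terminal_value_def)
qed

lemma val_real_nonneg: "\<lbrakk>(v, w) \<in> safe_set d; k \<le> N\<rbrakk> \<Longrightarrow> 0 \<le> w * Jv k (v / w)"
  using J_nonneg[OF _ safe_ratio_mem, of k v w] by (auto simp: safe_set_def)

text \<open>A bound on the nonnegative integral passes to the Bochner integral. The latter is 0 by
  convention when integrability fails, a case covered by nonnegativity of the bound.\<close>

lemma expectation_safe_policy_le:
  assumes \<pi>: "\<pi> \<in> safe_policies \<epsilon> d \<X> N k (v, w)" and s: "(v, w) \<in> safe_set d" and k: "k \<le> N"
  shows "(\<integral>\<omega>. terminal_value X \<epsilon> \<X> N k (v, w) \<pi> \<omega> \<partial>M) \<le> w * Jv k (v / w)"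
  using nn_integral_val_le[OF \<pi> s k order_refl] terminal_value_nn_integral(2)[OF \<pi> s]
    val_real_nonneg[OF s k]
  by (intro integral_real_bounded) (simp_all add: val_def)

section \<open>Optimality of the feedback law\<close>

context
  fixes \<gamma> :: "nat \<Rightarrow> real \<Rightarrow> real^'m"
  assumes sel: "\<And>k. k < N \<Longrightarrow> bellman_selector M X \<epsilon> d \<X> N k (\<gamma> k)"
begin

lemma selector_mem:
  assumes "k < N" "z \<in> I"
  shows "\<gamma> k z \<in> \<Gamma> k"
proof -
  have "\<gamma> k \<in> restrict_space borel I \<rightarrow>\<^sub>M restrict_space borel (\<Gamma> k)"
    using sel[OF assms(1)] unfolding bellman_selector_def by (rule conjunct1)
  from measurable_space[OF this, of z] assms(2) show ?thesis
    by (simp add: space_restrict_space)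
qed

lemma feedback_safe:
  assumes "k < N" "s \<in> safe_set d" "x \<in> \<X> k"
  shows "step \<epsilon> (feedback d \<gamma> k s) x s \<in> safe_set d"
proof -
  obtain v w where s: "s = (v, w)" by fastforce
  then have safe: "(v, w) \<in> safe_set d" using assms by simp
  have "\<forall>y\<in>\<X> k. step \<epsilon> (feedback d \<gamma> k s) y (v, w) \<in> safe_set d"
  proof (rule robustly_safe_control_iff[THEN iffD2, OF d safe cpt[OF assms(1)] ne[OF assms(1)]])
    show "0 < worst_loss \<epsilon> (\<X> k) u" if "u \<noteq> 0" for u
      by (rule pos[OF assms(1) that])
    show "\<exists>g\<in>\<Gamma> k. feedback d \<gamma> k s = (v - (1 - d) * w) *\<^sub>R g"
      unfolding s feedback_eq[OF safe] using selector_mem[OF assms(1) safe_ratio_mem[OF safe]] by blast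
  qed
  with assms s show ?thesis by blast
qed

text \<open>
  The selectors are measurable only on \<open>[1 - d, 1]\<close>; since the closed loop stays safe, extending
  them by \<open>0\<close> does not change it.
\<close>

lemma feedback_policy_causal:
  assumes s: "s \<in> safe_set d"
  shows "feedback_policy \<epsilon> d \<gamma> k s \<in> causal_policies \<X> N k"
  unfolding causal_policies_def mem_Collect_eq
proof
  fix j assume "j \<in> {k..<N}"
  then have j: "k \<le> j" "j < N" by auto
  define \<gamma>' where "\<gamma>' i z = (if z \<in> I then \<gamma> i z else 0)" for i z
  have "\<gamma>' i \<in> borel \<rightarrow>\<^sub>M borel" if "i < N" for i
  proof -
    have "\<gamma> i \<in> restrict_space borel I \<rightarrow>\<^sub>M borel"
      using sel[OF that] by (simp add: bellman_selector_def measurable_restrict_space2_iff)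
    then show ?thesis
      unfolding \<gamma>'_def by (subst measurable_restrict_space_iff[symmetric]) auto
  qed
  then have fb: "feedback d \<gamma>' i \<in> borel \<rightarrow>\<^sub>M borel" if "i < N" for i
    using that by (intro measurable_feedback) auto
  have eq: "feedback d \<gamma>' i t = feedback d \<gamma> i t" if "t \<in> safe_set d" for i t
    using that safe_ratio_mem[of "fst t" "snd t" d]
    by (auto simp: feedback_def \<gamma>'_def case_prod_beta)
  let ?P = "\<Pi>\<^sub>M i\<in>{..<j}. restrict_space borel (\<X> i)"
  have "(\<lambda>x. x i) \<in> ?P \<rightarrow>\<^sub>M borel" if "i < j" for i
    using measurable_component_singleton[of i "{..<j}" "\<lambda>i. restrict_space borel (\<X> i)"] that
    by (simp add: measurable_restrict_space2_iff)
  then have "(\<lambda>x. run \<epsilon> (feedback d \<gamma>') k s (\<lambda>i. x i) j) \<in> ?P \<rightarrow>\<^sub>M borel"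
    using j by (intro measurable_run fb) auto
  then have "(\<lambda>x. feedback d \<gamma>' j (run \<epsilon> (feedback d \<gamma>') k s x j)) \<in> ?P \<rightarrow>\<^sub>M borel"
    using fb[OF j(2)] by (auto intro: measurable_compose)
  moreover have "feedback d \<gamma>' j (run \<epsilon> (feedback d \<gamma>') k s x j) = feedback_policy \<epsilon> d \<gamma> k s j x"
    if "x \<in> space ?P" for x
  proof -
    have x: "x i \<in> \<X> i" if "i < j" for i
      using \<open>x \<in> space ?P\<close> that by (auto simp: space_PiM space_restrict_space)
    \<comment> \<open>Safety is needed along the run of the original law, where
      \<open>run_cong\<close> compares the two. The case \<open>i = j\<close> is included because
      the rule of stage \<open>j\<close> is evaluated there.\<close>
    have safe: "run \<epsilon> (feedback d \<gamma>) k s x i \<in> safe_set d" if "i \<le> j" for i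
    proof (rule run_safe[OF s])
      fix l assume "k \<le> l" "l < i" and l: "run \<epsilon> (feedback d \<gamma>) k s x l \<in> safe_set d"
      then have "l < N" "x l \<in> \<X> l" using that j x by simp_all
      with l show "step \<epsilon> (feedback d \<gamma> l (run \<epsilon> (feedback d \<gamma>) k s x l)) (x l)
          (run \<epsilon> (feedback d \<gamma>) k s x l) \<in> safe_set d"
        by (intro feedback_safe)
    qed
    have "run \<epsilon> (feedback d \<gamma>') k s x j = run \<epsilon> (feedback d \<gamma>) k s x j"
      using safe by (intro run_cong eq) auto
    then show ?thesis
      using eq safe by (simp add: feedback_policy_def)
  qed
  ultimately show "feedback_policy \<epsilon> d \<gamma> k s j \<in> ?P \<rightarrow>\<^sub>M borel"
    by (subst measurable_cong[symmetric]) auto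
qed

lemma feedback_policy_safe:
  assumes s: "s \<in> safe_set d"
  shows "feedback_policy \<epsilon> d \<gamma> k s \<in> safe_policies \<epsilon> d \<X> N k s"
  unfolding safe_policies_def
  using feedback_policy_causal[OF s]
  by (auto simp: control_feedback_policy policy_state_feedback_policy intro: feedback_safe)

text \<open>The induction of the upper bound, with the selector at the current ratio as
  \<open>\<gamma>\<close>; each Bellman inequality becomes an equality.\<close>

lemma nn_integral_val_feedback:
  assumes s: "s \<in> safe_set d" and "k \<le> j" "j \<le> N"
  shows "(\<integral>\<^sup>+\<omega>. val j (policy_state \<epsilon> \<X> (feedback_policy \<epsilon> d \<gamma> k s) k s (\<lambda>i. X i \<omega>) j) \<partial>M) = val k s"
  using assms(2,3)
proof (induction rule: dec_induct)
  case base
  then show ?case by (simp add: policy_state_def run_before emeasure_space_1)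
next
  case (step j)
  let ?\<pi> = "feedback_policy \<epsilon> d \<gamma> k s"
  let ?S = "\<lambda>x. policy_state \<epsilon> \<X> ?\<pi> k s x j"
  let ?g = "\<lambda>x. \<gamma> j (fst (?S x) / snd (?S x))"
  note \<pi> = feedback_policy_safe[OF s]
  have j: "k \<le> j" "j < N" using step by auto
  have safe: "?S x \<in> safe_set d" if "\<And>i. i < N \<Longrightarrow> x i \<in> \<X> i" for x
    using that j by (intro policy_state_safe[OF \<pi> s]) auto
  have g: "?g x \<in> \<Gamma> j \<and> control \<X> ?\<pi> j x = (fst (?S x) - (1 - d) * snd (?S x)) *\<^sub>R ?g x"
    if "\<And>i. i < N \<Longrightarrow> x i \<in> \<X> i" for x
  proof
    have safe': "(fst (?S x), snd (?S x)) \<in> safe_set d"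
      using safe[of x] that by simp
    show "?g x \<in> \<Gamma> j"
      by (rule selector_mem[OF j(2) safe_ratio_mem[OF safe']])
    show "control \<X> ?\<pi> j x = (fst (?S x) - (1 - d) * snd (?S x)) *\<^sub>R ?g x"
      using feedback_eq[OF safe', of \<gamma> j] that j
      by (simp add: control_feedback_policy policy_state_feedback_policy)
  qed
  have "(\<integral>\<^sup>+\<omega>. val (Suc j) (policy_state \<epsilon> \<X> ?\<pi> k s (\<lambda>i. X i \<omega>) (Suc j)) \<partial>M) =
    (\<integral>\<^sup>+\<omega>. (case ?S (\<lambda>i. X i \<omega>) of (v, w) \<Rightarrow>
       ennreal (w * Q j (Jv (Suc j)) (v / w) (?g (\<lambda>i. X i \<omega>)))) \<partial>M)"
    by (rule nn_integral_val_Suc[OF \<pi> s j g])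
  also have "\<dots> = (\<integral>\<^sup>+\<omega>. val j (?S (\<lambda>i. X i \<omega>)) \<partial>M)"
  proof (rule nn_integral_cong_AE)
    show "AE \<omega> in M. (case ?S (\<lambda>i. X i \<omega>) of (v, w) \<Rightarrow>
        ennreal (w * Q j (Jv (Suc j)) (v / w) (?g (\<lambda>i. X i \<omega>)))) = val j (?S (\<lambda>i. X i \<omega>))"
      using AE_returns
    proof eventually_elim
      case (elim \<omega>)
      obtain v w where vw: "?S (\<lambda>i. X i \<omega>) = (v, w)" by fastforce
      then have "v / w \<in> I"
        using safe[of "\<lambda>i. X i \<omega>"] elim by (intro safe_ratio_mem) auto
      then have "Q j (Jv (Suc j)) (v / w) (\<gamma> j (v / w)) = Jv j (v / w)"
        using sel[OF j(2)] unfolding bellman_selector_def by blast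
      then show ?case by (simp add: vw val_def)
    qed
  qed
  also have "\<dots> = val k s" using step by simp
  finally show ?case .
qed

text \<open>A finite nonnegative integral of a measurable, almost surely nonnegative function yields
  integrability together with the value; integrability is used again for the expected
  return.\<close>

lemma expectation_feedback_policy:
  assumes s: "(v, w) \<in> safe_set d" and k: "k \<le> N"
  defines "V \<equiv> terminal_value X \<epsilon> \<X> N k (v, w) (feedback_policy \<epsilon> d \<gamma> k (v, w))"
  shows "integrable M V" and "(\<integral>\<omega>. V \<omega> \<partial>M) = w * Jv k (v / w)"
proof -
  note \<pi> = feedback_policy_safe[OF s, of k]
  have "(\<integral>\<^sup>+\<omega>. ennreal (V \<omega>) \<partial>M) = ennreal (w * Jv k (v / w))"
    using nn_integral_val_feedback[OF s k order_refl] terminal_value_nn_integral(2)[OF \<pi> s]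
    by (simp add: val_def V_def)
  then have "integrable M V \<and> (\<integral>\<omega>. V \<omega> \<partial>M) = w * Jv k (v / w)"
    using terminal_value_nn_integral(1)[OF \<pi> s] val_real_nonneg[OF s k]
      terminal_value_measurable[OF feedback_policy_causal[OF s]]
    by (subst nn_integral_eq_integrable[symmetric]) (auto simp: V_def)
  then show "integrable M V" "(\<integral>\<omega>. V \<omega> \<partial>M) = w * Jv k (v / w)" by auto
qed

end

text \<open>In \<open>ereal\<close> the supremum exists without a prior bound. The feedback policy
  of any family of selectors attains it.\<close>

lemma SUP_safe_policies:
  assumes s: "(v, w) \<in> safe_set d" and k: "k \<le> N"
  shows "(SUP \<pi>\<in>safe_policies \<epsilon> d \<X> N k (v, w).
            ereal (\<integral>\<omega>. terminal_value X \<epsilon> \<X> N k (v, w) \<pi> \<omega> \<partial>M)) = ereal (w * Jv k (v / w))"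
proof (rule antisym)
  show "(SUP \<pi>\<in>safe_policies \<epsilon> d \<X> N k (v, w).
      ereal (\<integral>\<omega>. terminal_value X \<epsilon> \<X> N k (v, w) \<pi> \<omega> \<partial>M)) \<le> ereal (w * Jv k (v / w))"
    using expectation_safe_policy_le[OF _ s k] by (intro SUP_least) simp
  have "\<forall>k\<in>{..<N}. \<exists>\<gamma>. bellman_selector M X \<epsilon> d \<X> N k \<gamma>"
    using bellman_selector_exists by blast
  then obtain \<gamma> where "\<forall>k\<in>{..<N}. bellman_selector M X \<epsilon> d \<X> N k (\<gamma> k)"
    by (elim bchoice[THEN exE])
  then have \<gamma>: "\<And>k. k < N \<Longrightarrow> bellman_selector M X \<epsilon> d \<X> N k (\<gamma> k)" by blast
  show "ereal (w * Jv k (v / w)) \<le> (SUP \<pi>\<in>safe_policies \<epsilon> d \<X> N k (v, w).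
      ereal (\<integral>\<omega>. terminal_value X \<epsilon> \<X> N k (v, w) \<pi> \<omega> \<partial>M))"
    by (rule SUP_upper2[OF feedback_policy_safe[OF \<gamma> s]])
       (simp_all add: expectation_feedback_policy(2)[OF \<gamma> s k])
qed

end

text \<open>Optimality is claimed for every family of Bellman selectors, and the existence clause
  keeps this from being vacuous. Invariance is stated over all safe states, which makes sense since
  a feedback law, unlike a rule based on returns, is a function of the state.\<close>

theorem theorem4p4:
  fixes M :: "'a measure" and X :: "nat \<Rightarrow> 'a \<Rightarrow> real^'m" and \<X> :: "nat \<Rightarrow> (real^'m) set"
    and \<epsilon> :: "real^'m" and d V0 :: real and N :: nat
  assumes "prob_space M" and "1 \<le> N" and "0 < V0" and "\<forall>i. 0 \<le> \<epsilon> $ i"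
    and "0 \<le> d" and "d < 1"
    and "\<forall>k<N. \<X> k \<noteq> {} \<and> compact (\<X> k)"
    and "\<forall>k<N. X k \<in> borel_measurable M"
    and "\<forall>k<N. AE \<omega> in M. X k \<omega> \<in> \<X> k"
    and "\<forall>k<N. \<forall>u. u \<noteq> 0 \<longrightarrow> 0 < worst_loss \<epsilon> (\<X> k) u"
    and "\<forall>k<N. prob_space.indep_set M {X k -` A \<inter> space M | A. A \<in> sets borel}
                 (sets (past_algebra M X k))"
  shows "(\<forall>k\<le>N. \<forall>(v, w)\<in>safe_set d.
            (SUP \<pi>\<in>safe_policies \<epsilon> d \<X> N k (v, w).
               ereal (\<integral>\<omega>. terminal_value X \<epsilon> \<X> N k (v, w) \<pi> \<omega> \<partial>M))
            = ereal (w * J M X \<epsilon> d \<X> N k (v / w))) \<and>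
         (\<forall>k<N. \<exists>\<gamma>. bellman_selector M X \<epsilon> d \<X> N k \<gamma>) \<and>
         (\<forall>\<gamma>. (\<forall>k<N. bellman_selector M X \<epsilon> d \<X> N k (\<gamma> k)) \<longrightarrow>
            (\<forall>k<N. \<forall>s\<in>safe_set d. \<forall>x\<in>\<X> k. step \<epsilon> (feedback d \<gamma> k s) x s \<in> safe_set d) \<and>
            (\<forall>k\<le>N. \<forall>(v, w)\<in>safe_set d.
               let \<pi> = feedback_policy \<epsilon> d \<gamma> k (v, w) in
                 \<pi> \<in> safe_policies \<epsilon> d \<X> N k (v, w) \<and>
                 (\<forall>j\<in>{k..<N}. \<forall>x. (\<forall>i<j. x i \<in> \<X> i) \<longrightarrow>
                    control \<X> \<pi> j x = feedback d \<gamma> j (policy_state \<epsilon> \<X> \<pi> k (v, w) x j)) \<and>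
                 (\<integral>\<omega>. terminal_value X \<epsilon> \<X> N k (v, w) \<pi> \<omega> \<partial>M) = w * J M X \<epsilon> d \<X> N k (v / w)) \<and>
            (let V = terminal_value X \<epsilon> \<X> N 0 (V0, V0) (feedback_policy \<epsilon> d \<gamma> 0 (V0, V0)) in
               (\<integral>\<omega>. V \<omega> \<partial>M) = V0 * J M X \<epsilon> d \<X> N 0 1 \<and>
               (\<integral>\<omega>. (V \<omega> - V0) / V0 \<partial>M) = J M X \<epsilon> d \<X> N 0 1 - 1))"
proof -
  interpret drawdown_control M X \<X> \<epsilon> d N
    using assms by (intro drawdown_control.intro drawdown_control_axioms.intro) auto
  have 1: "\<forall>k\<le>N. \<forall>(v, w)\<in>safe_set d.
      (SUP \<pi>\<in>safe_policies \<epsilon> d \<X> N k (v, w).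
         ereal (\<integral>\<omega>. terminal_value X \<epsilon> \<X> N k (v, w) \<pi> \<omega> \<partial>M)) = ereal (w * J M X \<epsilon> d \<X> N k (v / w))"
    using SUP_safe_policies by blast
  have 2: "\<forall>k<N. \<exists>\<gamma>. bellman_selector M X \<epsilon> d \<X> N k \<gamma>"
    using bellman_selector_exists by blast
  have 3: "(\<forall>k<N. \<forall>s\<in>safe_set d. \<forall>x\<in>\<X> k. step \<epsilon> (feedback d \<gamma> k s) x s \<in> safe_set d) \<and>
      (\<forall>k\<le>N. \<forall>(v, w)\<in>safe_set d.
         let \<pi> = feedback_policy \<epsilon> d \<gamma> k (v, w) in
           \<pi> \<in> safe_policies \<epsilon> d \<X> N k (v, w) \<and>
           (\<forall>j\<in>{k..<N}. \<forall>x. (\<forall>i<j. x i \<in> \<X> i) \<longrightarrow>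
              control \<X> \<pi> j x = feedback d \<gamma> j (policy_state \<epsilon> \<X> \<pi> k (v, w) x j)) \<and>
           (\<integral>\<omega>. terminal_value X \<epsilon> \<X> N k (v, w) \<pi> \<omega> \<partial>M) = w * J M X \<epsilon> d \<X> N k (v / w)) \<and>
      (let V = terminal_value X \<epsilon> \<X> N 0 (V0, V0) (feedback_policy \<epsilon> d \<gamma> 0 (V0, V0)) in
         (\<integral>\<omega>. V \<omega> \<partial>M) = V0 * J M X \<epsilon> d \<X> N 0 1 \<and>
         (\<integral>\<omega>. (V \<omega> - V0) / V0 \<partial>M) = J M X \<epsilon> d \<X> N 0 1 - 1)"
    if \<gamma>: "\<forall>k<N. bellman_selector M X \<epsilon> d \<X> N k (\<gamma> k)" for \<gamma>
  proof -
    have sel: "bellman_selector M X \<epsilon> d \<X> N k (\<gamma> k)" if "k < N" for k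
      using \<gamma> that by blast
    define V where "V = terminal_value X \<epsilon> \<X> N 0 (V0, V0) (feedback_policy \<epsilon> d \<gamma> 0 (V0, V0))"
    have "(V0, V0) \<in> safe_set d"
      using assms(3,5) by (simp add: safe_set_def algebra_simps)
    note V0 = expectation_feedback_policy[OF sel this le0, folded V_def]
    have EV: "(\<integral>\<omega>. V \<omega> \<partial>M) = V0 * J M X \<epsilon> d \<X> N 0 1"
      using V0(2) assms(3) by simp
    \<comment> \<open>Splitting the integral by linearity relies on the integrability recorded in
      \<open>V0(1)\<close>.\<close>
    moreover have "(\<integral>\<omega>. (V \<omega> - V0) / V0 \<partial>M) = J M X \<epsilon> d \<X> N 0 1 - 1"
      using V0(1) EV assms(3) by (simp add: prob_space field_simps)
    moreover have "control \<X> (feedback_policy \<epsilon> d \<gamma> k t) j x =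
        feedback d \<gamma> j (policy_state \<epsilon> \<X> (feedback_policy \<epsilon> d \<gamma> k t) k t x j)"
      if "\<forall>i<j. x i \<in> \<X> i" for k j t x
      using that by (simp add: control_feedback_policy policy_state_feedback_policy)
    ultimately show ?thesis
      using feedback_safe[OF sel] feedback_policy_safe[OF sel] expectation_feedback_policy(2)[OF sel]
      unfolding Let_def V_def by (intro conjI ballI allI impI) auto
  qed
  show ?thesis
    using 1 2 3 by blast
qed

end
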